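(* Let $\mu$ be a probability measure on $\mathbb{R}^d$ with compact support $\mathbf{\Omega}$ and density $f$ with respect to the Lebesgue measure, and suppose that for every $\emptyset\neq A\subseteq[d]$: (i) $\mathbf{\Omega}_A=\mathrm{cl}(\mathrm{int}(\mathbf{\Omega}_A))$; (ii) the marginal density $f_A$ is continuous and positive on $\mathrm{int}(\mathbf{\Omega}_A)$; (iii) $f_A=0$ outside of $\mathbf{\Omega}_A$. Let $G$ be a graphical model for $\mu$ with junction tree $J$. Let $\epsilon>0$. For any $\mathbf{z}\in\mathbb{R}^d$ with $B_\infty(\mathbf{z},\epsilon)\subseteq\mathbf{\Omega}$, we have $$\lim_{n\to\infty}\epsilon^{-d}\cdot\widetilde\Gamma_n^{\mu,G,J}(\mathbf{z};\epsilon)^{-1}=\frac{\prod_{C\in V(J)}f_C(\zeta^C)}{\prod_{\{A,B\}\in E(J)}f_{A\cap B}(\zeta^{A\cap B})},$$ where, for each $D\in V(J)\cup\{A\cap B:\{A,B\}\in E(J)\}$, $\zeta^D$ is some point of $B_\infty(\mathbf{z}_D,\epsilon)\subseteq\mathbb{R}^d_D$. Here $\widetilde\Gamma_n^{\mu,G,J}$ is the regularized rational Christoffel function of $\mu$ associated with $G$ and $J$.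
   Context: Notation. $[d]=\{1,\dots,d\}$. For $A\subseteq[d]$, $\mathbb{R}^d_A$ is the span of the standard basis vectors $e_k$, $k\in A$; $\mathbf{x}_A=(x_k)_{k\in A}\in\mathbb{R}^d_A$ is the projection of $\mathbf{x}\in\mathbb{R}^d$; $\mathbf{\Omega}_A=\{\mathbf{x}_A:\mathbf{x}\in\mathbf{\Omega}\}$. Closure $\mathrm{cl}$ and interior $\mathrm{int}$ of $\mathbf{\Omega}_A$ are taken in $\mathbb{R}^d_A$. $\mu_A$ is the marginal of $\mu$ on $\mathbb{R}^d_A$, with density $f_A(\mathbf{x}_A)=\int f(\mathbf{x}_A,\mathbf{x}_{[d]\setminus A})\,d\mathbf{x}_{[d]\setminus A}$ (and $f_\emptyset=1$). $B_\infty(\mathbf{z},\epsilon)=\{\mathbf{x}:\|\mathbf{x}-\mathbf{z}\|_\infty\le\frac12\epsilon\}$ is the closed $L_\infty$-ball of diameter $\epsilon$ around $\mathbf{z}$, in $\mathbb{R}^d$ or, for $\mathbf{z}_D$, in $\mathbb{R}^d_D$. Graphical models. For $A,B,C\subseteq[d]$, $A\perp_\mu B\,|\,C$ (conditional independence) means $f_C(\mathbf{x}_C)\,f_{A\cup B\cup C}(\mathbf{x}_{A\cup B\cup C})=f_{A\cup C}(\mathbf{x}_{A\cup C})\,f_{B\cup C}(\mathbf{x}_{B\cup C})$, as an identity of densities (for almost every $\mathbf{x}$). In a simple graph $G$ on vertex set $[d]$, $A,B$ are separated by $C$ if every path (including one-vertex paths) between a vertex of $A$ and a vertex of $B$ contains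 a vertex of $C$. $G$ is a graphical model for $\mu$ if for all $A,B,C\subseteq[d]$: $A,B$ separated by $C$ in $G$ implies $A\perp_\mu B\,|\,C$. Junction trees. A graph is chordal if every cycle of length greater than 3 has a chord. A chordal completion of $G$ is a chordal graph $\overline G$ on the same vertex set with $E(G)\subseteq E(\overline G)$. A junction tree $J$ for $G$ is a tree whose vertex set $V(J)$ is the set of maximal cliques of some chordal completion of $G$, with the clique-intersection property: for every $C\in V(J)$ on the path between $A,B\in V(J)$ in $J$, $A\cap B\subseteq C$. $E(J)$ denotes its edge set. Regularized Christoffel polynomials. For $D\subseteq[d]$ and $n\in\mathbb{N}$, $\mathbb{R}[\mathbf{x}_D]_{\otimes n}$ is the space of real polynomials in the variables $x_k$, $k\in D$, of degree at most $n$ in each variable. For $\mathbf{z}\in\mathbb{R}^d_D$ and $\epsilon>0$, $$\widetilde\Lambda_{\otimes n}^{\mu_D}(\mathbf{z};\epsilon)^{-1}:=\min_{p\in\mathbb{R}[\mathbf{x}_D]_{\otimes n}}\Big\{\int p^2\,d\mu_D:\ \int_{B_\infty(\mathbf{z},\epsilon)}p(\mathbf{y})\,\frac{d\mathbf{y}}{\epsilon^{|D|}}=1\Big\},$$ and $\widetilde\Lambda_{\otimes n}^{\mu_\emptyset}=1$. The regularized rational Christoffel function is $$\widetilde\Gamma_n^{\mu,G,J}(\mathbf{x};\epsilon):=\frac{\prod_{C\in V(J)}\widetilde\Lambda_{\otimes n}^{\mu_C}(\mathbf{x}_C;\epsilon)}{\prod_{\{A,B\}\in E(J)}\widetilde\Lambda_{\otimes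 n}^{\mu_{A\cap B}}(\mathbf{x}_{A\cap B};\epsilon)}.$$
   Formalization: Added: for each clique C in V(J), f_C attains its minimum on B_∞(z_C,ε); without it the claim fails, e.g. d=1, Ω=[0,1], f(x)=2x on (0,1], f(0)=1, z=1/4, ε=1/2, where the limit is 0 but f>0 on the cube. *)

theory Defs
  imports "HOL-Probability.Probability"
begin

section \<open>Coordinate subspaces\<close>

text \<open>
  \<open>\<real>\<^sup>d\<^sub>A\<close> is represented by \<open>\<real>\<^sup>A\<close>: functions on \<open>A \<subseteq> {1..d}\<close>, undefined outside \<open>A\<close>. The full space
  is the case \<open>A = {1..d}\<close>, and the projection \<open>\<^bold>x \<mapsto> \<^bold>x\<^sub>A\<close> is \<open>\<lambda>x. restrict x A\<close>.
\<close>

definition RA :: "nat set \<Rightarrow> (nat \<Rightarrow> real) set" where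
  "RA A = (\<Pi>\<^sub>E k\<in>A. UNIV)"

definition RA_top :: "nat set \<Rightarrow> (nat \<Rightarrow> real) topology" where
  "RA_top A = product_topology (\<lambda>_. euclideanreal) A"

definition leb :: "nat set \<Rightarrow> (nat \<Rightarrow> real) measure" where
  "leb A = (\<Pi>\<^sub>M k\<in>A. lborel)"

definition proj :: "nat set \<Rightarrow> (nat \<Rightarrow> real) set \<Rightarrow> (nat \<Rightarrow> real) set" where
  "proj A S = (\<lambda>x. restrict x A) ` S"

definition supp :: "nat set \<Rightarrow> (nat \<Rightarrow> real) measure \<Rightarrow> (nat \<Rightarrow> real) set" where
  "supp A \<mu> = {x \<in> RA A. \<forall>U. openin (RA_top A) U \<and> x \<in> U \<longrightarrow> 0 < emeasure \<mu> U}"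

text \<open>The closed \<open>L\<^sub>\<infinity>\<close>-ball of diameter (not radius) \<open>\<epsilon>\<close>; only the coordinates of \<open>z\<close> in \<open>D\<close> matter.\<close>

definition B_inf :: "nat set \<Rightarrow> (nat \<Rightarrow> real) \<Rightarrow> real \<Rightarrow> (nat \<Rightarrow> real) set" where
  "B_inf D z \<epsilon> = {x \<in> RA D. \<forall>k\<in>D. \<bar>x k - z k\<bar> \<le> \<epsilon> / 2}"

section \<open>Marginals\<close>

definition marginal :: "nat set \<Rightarrow> (nat \<Rightarrow> real) measure \<Rightarrow> (nat \<Rightarrow> real) measure" where
  "marginal A \<mu> = distr \<mu> (leb A) (\<lambda>x. restrict x A)"

definition marginal_density ::
    "nat \<Rightarrow> ((nat \<Rightarrow> real) \<Rightarrow> real) \<Rightarrow> nat set \<Rightarrow> (nat \<Rightarrow> real) \<Rightarrow> real" where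
  "marginal_density d f A x =
    (if A = {} then 1
     else (LINT y|leb ({1..d} - A). f (merge A ({1..d} - A) (x, y))))"

text \<open>Conditional independence \<open>A \<bottom> B | C\<close>, as an identity between marginal densities.\<close>

definition cond_indep ::
    "nat \<Rightarrow> ((nat \<Rightarrow> real) \<Rightarrow> real) \<Rightarrow> nat set \<Rightarrow> nat set \<Rightarrow> nat set \<Rightarrow> bool" where
  "cond_indep d f A B C \<longleftrightarrow>
    (AE x in leb {1..d}.
       marginal_density d f C (restrict x C)
         * marginal_density d f (A \<union> B \<union> C) (restrict x (A \<union> B \<union> C))
       = marginal_density d f (A \<union> C) (restrict x (A \<union> C))
         * marginal_density d f (B \<union> C) (restrict x (B \<union> C)))"

section \<open>Graphs\<close>

text \<open>A graph is a pair of a vertex set and a set of edges, each edge being a two-element set.\<close>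

type_synonym 'a ugraph = "'a set \<times> 'a set set"

abbreviation verts :: "'a ugraph \<Rightarrow> 'a set" where "verts G \<equiv> fst G"
abbreviation edges :: "'a ugraph \<Rightarrow> 'a set set" where "edges G \<equiv> snd G"

definition simple_graph :: "'a ugraph \<Rightarrow> bool" where
  "simple_graph G \<longleftrightarrow> finite (verts G) \<and> (\<forall>e\<in>edges G. e \<subseteq> verts G \<and> card e = 2)"

text \<open>The length of the list is the number of vertices of the path.\<close>

definition is_path :: "'a ugraph \<Rightarrow> 'a list \<Rightarrow> bool" where
  "is_path G p \<longleftrightarrow> p \<noteq> [] \<and> distinct p \<and> set p \<subseteq> verts G
     \<and> successively (\<lambda>u v. {u, v} \<in> edges G) p"

definition is_cycle :: "'a ugraph \<Rightarrow> 'a list \<Rightarrow> bool" where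
  "is_cycle G p \<longleftrightarrow> is_path G p \<and> 3 \<le> length p \<and> {last p, hd p} \<in> edges G"

definition has_chord :: "'a ugraph \<Rightarrow> 'a list \<Rightarrow> bool" where
  "has_chord G p \<longleftrightarrow>
    (\<exists>i j. i < j \<and> j < length p \<and> j \<noteq> Suc i \<and> \<not> (i = 0 \<and> j = length p - 1)
       \<and> {p ! i, p ! j} \<in> edges G)"

definition chordal :: "'a ugraph \<Rightarrow> bool" where
  "chordal G \<longleftrightarrow> (\<forall>p. is_cycle G p \<and> 3 < length p \<longrightarrow> has_chord G p)"

definition chordal_completion :: "'a ugraph \<Rightarrow> 'a ugraph \<Rightarrow> bool" where
  "chordal_completion G H \<longleftrightarrow>
     simple_graph H \<and> chordal H \<and> verts H = verts G \<and> edges G \<subseteq> edges H"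

definition is_clique :: "'a ugraph \<Rightarrow> 'a set \<Rightarrow> bool" where
  "is_clique G K \<longleftrightarrow> K \<subseteq> verts G \<and> (\<forall>u\<in>K. \<forall>v\<in>K. u \<noteq> v \<longrightarrow> {u, v} \<in> edges G)"

definition max_cliques :: "'a ugraph \<Rightarrow> 'a set set" where
  "max_cliques G = {K. is_clique G K \<and> (\<forall>L. is_clique G L \<and> K \<subseteq> L \<longrightarrow> L = K)}"

definition is_tree :: "'a ugraph \<Rightarrow> bool" where
  "is_tree T \<longleftrightarrow> simple_graph T \<and> verts T \<noteq> {}
     \<and> (\<forall>u\<in>verts T. \<forall>v\<in>verts T. \<exists>p. is_path T p \<and> hd p = u \<and> last p = v)
     \<and> (\<forall>p. \<not> is_cycle T p)"

definition junction_tree :: "'a ugraph \<Rightarrow> 'a set ugraph \<Rightarrow> bool" where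
  "junction_tree G J \<longleftrightarrow>
     is_tree J
     \<and> (\<exists>H. chordal_completion G H \<and> verts J = max_cliques H)
     \<and> (\<forall>p. is_path J p \<longrightarrow> (\<forall>C\<in>set p. hd p \<inter> last p \<subseteq> C))"

definition separated :: "'a ugraph \<Rightarrow> 'a set \<Rightarrow> 'a set \<Rightarrow> 'a set \<Rightarrow> bool" where
  "separated G A B C \<longleftrightarrow>
     (\<forall>p. is_path G p \<and> hd p \<in> A \<and> last p \<in> B \<longrightarrow> set p \<inter> C \<noteq> {})"

text \<open>\<open>G\<close> is a graphical model for the measure on \<open>\<real>\<^sup>d\<close> with Lebesgue density \<open>f\<close>.\<close>

definition graphical_model :: "nat \<Rightarrow> ((nat \<Rightarrow> real) \<Rightarrow> real) \<Rightarrow> nat ugraph \<Rightarrow> bool" where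
  "graphical_model d f G \<longleftrightarrow>
     simple_graph G \<and> verts G = {1..d}
     \<and> (\<forall>A B C. A \<subseteq> {1..d} \<and> B \<subseteq> {1..d} \<and> C \<subseteq> {1..d} \<and> separated G A B C
            \<longrightarrow> cond_indep d f A B C)"

section \<open>Regularized Christoffel functions\<close>

text \<open>
  Real polynomials (as functions) in the variables \<open>x\<^sub>k\<close>, \<open>k \<in> D\<close>, of degree at most \<open>n\<close> in each
  variable.
\<close>

definition tensor_polys :: "nat set \<Rightarrow> nat \<Rightarrow> ((nat \<Rightarrow> real) \<Rightarrow> real) set" where
  "tensor_polys D n =
    {p. \<exists>c. p = (\<lambda>x. \<Sum>\<alpha>\<in>(\<Pi>\<^sub>E k\<in>D. {..n}). c \<alpha> * (\<Prod>k\<in>D. x k ^ \<alpha> k))}"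

text \<open>
  The minimum of a positive semidefinite quadratic form over a nonempty finite-dimensional affine
  space (it contains \<open>p = 1\<close>) is attained, so that the infimum below is a minimum. Beware of the
  convention: this minimum is the \<^emph>\<open>reciprocal\<close> of \<open>christoffel\<close>.
\<close>

definition christoffel_min ::
    "nat set \<Rightarrow> nat \<Rightarrow> (nat \<Rightarrow> real) measure \<Rightarrow> (nat \<Rightarrow> real) \<Rightarrow> real \<Rightarrow> real" where
  "christoffel_min D n \<nu> z \<epsilon> =
     Inf {(LINT x|\<nu>. (p x)\<^sup>2) | p.
            p \<in> tensor_polys D n \<and> (LINT y:B_inf D z \<epsilon>|leb D. p y / \<epsilon> ^ card D) = 1}"

definition christoffel ::
    "nat set \<Rightarrow> nat \<Rightarrow> (nat \<Rightarrow> real) measure \<Rightarrow> (nat \<Rightarrow> real) \<Rightarrow> real \<Rightarrow> real" where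
  "christoffel D n \<nu> z \<epsilon> = (if D = {} then 1 else inverse (christoffel_min D n \<nu> z \<epsilon>))"

text \<open>For an edge \<open>e = {A, B}\<close> of \<open>J\<close> the separator \<open>A \<inter> B\<close> is \<open>\<Inter>e\<close>.\<close>

definition rational_christoffel ::
    "nat \<Rightarrow> (nat \<Rightarrow> real) measure \<Rightarrow> nat ugraph \<Rightarrow> nat set ugraph \<Rightarrow> (nat \<Rightarrow> real) \<Rightarrow> real \<Rightarrow> real"
  where
  "rational_christoffel n \<mu> G J x \<epsilon> =
     (\<Prod>C\<in>verts J. christoffel C n (marginal C \<mu>) (restrict x C) \<epsilon>)
     / (\<Prod>e\<in>edges J. christoffel (\<Inter>e) n (marginal (\<Inter>e) \<mu>) (restrict x (\<Inter>e)) \<epsilon>)"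

section \<open>Boundary values of the density\<close>

text \<open>
  Continuity and positivity in the interior of the support leave the values of a density on the
  boundary arbitrary, while a cube contained in the support may touch the boundary. For
  \<open>d = 1\<close>, \<open>f x = 2 * x\<close> on \<open>{0<..1}\<close>, \<open>f 0 = 1\<close>, and the cube \<open>{0..1/2}\<close>, the function \<open>1 / f\<close> is not
  integrable on the cube, so the limit of the Christoffel minimum is \<open>0\<close>, although \<open>f\<close> has no zero
  in the cube. The following condition on a (clique) density \<open>g\<close> and a cube \<open>S\<close> excludes
  this kind of mismatch. It holds automatically if \<open>S\<close> lies in the interior of the
  support, or more generally if \<open>g\<close> is continuous on \<open>S\<close>.
\<close>

definition attains_min_on :: "('a \<Rightarrow> real) \<Rightarrow> 'a set \<Rightarrow> bool" where
  "attains_min_on g S \<longleftrightarrow> (\<exists>\<xi>\<in>S. \<forall>y\<in>S. g \<xi> \<le> g y)"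

end

theory Submission
  imports Defs
begin

text \<open>
  For a set \<open>D\<close> of coordinates, the Christoffel minimum is the smallest energy \<open>\<integral>p\<^sup>2 f\<^sub>D\<close> of a polynomial
  \<open>p\<close> whose mean over the cube is 1. Polynomials are uniformly dense in the continuous functions on
  the compact support, so that in the limit of large degree \<open>p\<close> ranges over all square integrable
  functions. There the Cauchy-Schwarz inequality shows that the optimal function is proportional to
  \<open>1 / f\<^sub>D\<close> on the cube and vanishes outside, with energy \<open>\<epsilon>^(2 * card D) / I\<close>, where \<open>I\<close> is the
  integral of \<open>1 / f\<^sub>D\<close> over the cube. This is \<open>\<epsilon> ^ card D\<close> times the harmonic mean of \<open>f\<^sub>D\<close>, and the
  harmonic mean of a continuous positive function on the (connected) open cube is one of its values
  \<open>f\<^sub>D \<zeta>\<close> (\<open>value_limit_pos_imp_mean_value\<close>).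

  In the product over the cliques, divided by the product over the separators, the powers of \<open>\<epsilon>\<close>
  combine to \<open>\<epsilon>^d\<close>: the cliques that contain a given coordinate form a subtree of the junction tree,
  so that every coordinate lies in exactly one more clique than separators, counting one separator
  for each edge (\<open>junction_tree_sum_card\<close>).

  One difficulty remains. The cube may touch the boundary of the support, \<open>f\<^sub>D\<close> may tend to 0 there,
  and \<open>1 / f\<^sub>D\<close> may fail to be integrable. Then \<open>I\<close> is infinite and the minimum tends to 0. For a
  clique this is consistent with the claim, since the density of a clique is assumed to attain its
  minimum on the cube, which is then 0. If it happens for a separator \<open>S\<close>, numerator and denominator of the quotient both tend to
  0. The decisive fact is then that the minimum for \<open>A\<close> is at most the minimum for every \<open>S \<subseteq> A\<close>, since
  a polynomial in the variables of \<open>S\<close> has the same energy and mean when it is read as a polynomial in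
  the variables of \<open>A\<close> (\<open>marginal_min_antimono\<close>). Let \<open>r\<close> be a clique that contains \<open>S\<close>, and root the
  tree at \<open>r\<close>. Pairing every other clique with the edge towards the root
  (\<open>tree_parent_edges\<close>) writes the quotient as the minimum of \<open>r\<close>, which tends to 0, times ratios in
  \<open>[0, 1]\<close>. So the limit is 0, and so is the right-hand side, if \<open>\<zeta>\<close> at \<open>r\<close> is a zero of the density
  and \<open>\<zeta>\<close> at the separators are points of positive density. These choices do not collide, because a
  separator is never itself a maximal clique.
\<close>

section \<open>Counting along trees and junction trees\<close>

definition adj :: "'a ugraph \<Rightarrow> ('a \<times> 'a) set" where
  "adj T = {(u, v). {u, v} \<in> edges T}"

lemma is_path_imp_rtrancl_adj:
  assumes "is_path T p"
  shows "(hd p, last p) \<in> (adj T)\<^sup>*"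
proof -
  have "p \<noteq> [] \<Longrightarrow> successively (\<lambda>u v. {u, v} \<in> edges T) p \<Longrightarrow> (hd p, last p) \<in> (adj T)\<^sup>*" for p
  proof (induction p rule: induct_list012)
    case (3 x y zs)
    then have "(x, y) \<in> adj T" "(y, last (y # zs)) \<in> (adj T)\<^sup>*"
      by (auto simp: adj_def)
    then show ?case by (simp add: converse_rtrancl_into_rtrancl)
  qed auto
  then show ?thesis using assms by (auto simp: is_path_def)
qed

text \<open>
  A walk becomes a path by cutting it back whenever it returns to a vertex visited before.
\<close>

lemma rtrancl_adj_imp_is_path:
  assumes "(u, v) \<in> (adj T)\<^sup>*" "u \<in> verts T" "simple_graph T"
  shows "\<exists>p. is_path T p \<and> hd p = u \<and> last p = v"
  using assms(1)
proof (induction rule: rtrancl_induct)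
  case base
  have "is_path T [u]" using assms by (auto simp: is_path_def)
  then show ?case by force
next
  case (step y x)
  then obtain p where p: "is_path T p" "hd p = u" "last p = y" by auto
  have e: "{y, x} \<in> edges T" using step by (auto simp: adj_def)
  then have xv: "x \<in> verts T" using assms(3) by (auto simp: simple_graph_def)
  show ?case
  proof (cases "x \<in> set p")
    case True
    then obtain q r where pq: "p = q @ x # r" by (meson split_list)
    have "is_path T (q @ [x])"
      using p(1) by (auto simp: is_path_def pq successively_append_iff)
    moreover have "hd (q @ [x]) = u" using p(2) by (cases q) (auto simp: pq)
    ultimately show ?thesis by force
  next
    case False
    have "is_path T (p @ [x])"
      using p e xv False by (auto simp: is_path_def successively_append_iff)
    moreover have "hd (p @ [x]) = u" using p by (auto simp: is_path_def)
    ultimately show ?thesis by force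
  qed
qed

text \<open>
  Every vertex other than the root is assigned the first edge of a shortest walk to the root. The
  distance to the root decreases along these edges, which makes the assignment injective and the
  assigned edges connected; any further edge would therefore close a cycle.
\<close>

lemma tree_parent_edges:
  assumes T: "is_tree T" and r: "r \<in> verts T"
  shows "\<exists>b. bij_betw b (verts T - {r}) (edges T) \<and> (\<forall>v\<in>verts T - {r}. v \<in> b v)"
proof -
  have simple: "simple_graph T" and nocyc: "\<And>p. \<not> is_cycle T p"
    using T by (auto simp: is_tree_def)
  have conn: "(v, r) \<in> (adj T)\<^sup>*" if "v \<in> verts T" for v
    using T that r is_path_imp_rtrancl_adj unfolding is_tree_def by metis
  define \<delta> where "\<delta> v = (LEAST n. (v, r) \<in> adj T ^^ n)" for v
  have \<delta>: "(v, r) \<in> adj T ^^ \<delta> v" if "v \<in> verts T" for v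
    unfolding \<delta>_def using conn[OF that] by (metis LeastI_ex rtrancl_power)
  have "\<exists>w. {v, w} \<in> edges T \<and> \<delta> w < \<delta> v" if v: "v \<in> verts T - {r}" for v
  proof -
    have "\<delta> v \<noteq> 0" using \<delta>[of v] v by (metis DiffE insertI1 relpow_0_E)
    then obtain m where m: "\<delta> v = Suc m" using not0_implies_Suc by blast
    then obtain w where w: "(v, w) \<in> adj T" "(w, r) \<in> adj T ^^ m"
      using \<delta>[of v] v by (metis DiffE relpow_Suc_D2)
    then have "\<delta> w \<le> m" unfolding \<delta>_def by (simp add: Least_le)
    then show ?thesis using w m by (auto simp: adj_def)
  qed
  then obtain par where par:
    "\<And>v. v \<in> verts T - {r} \<Longrightarrow> {v, par v} \<in> edges T \<and> \<delta> (par v) < \<delta> v"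
    by metis
  define b where "b v = {v, par v}" for v
  define T' where "T' = (verts T, b ` (verts T - {r}))"
  have parv: "par v \<in> verts T" if "v \<in> verts T - {r}" for v
    using par[OF that] simple by (auto simp: simple_graph_def)
  have simple': "simple_graph T'"
    unfolding simple_graph_def
  proof (intro conjI ballI)
    show "finite (verts T')" using simple by (simp add: simple_graph_def T'_def)
    fix e assume "e \<in> edges T'"
    then have "e \<in> edges T" using par by (force simp: T'_def b_def)
    then show "e \<subseteq> verts T'" "card e = 2" using simple by (simp_all add: simple_graph_def T'_def)
  qed
  have conn': "(v, r) \<in> (adj T')\<^sup>*" if "v \<in> verts T" for v
    using that
  proof (induction "\<delta> v" arbitrary: v rule: less_induct)
    case less
    show ?case
    proof (cases "v = r")
      case False
      then have v: "v \<in> verts T - {r}" using less by auto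
      then have "(v, par v) \<in> adj T'" by (auto simp: adj_def T'_def b_def)
      then show ?thesis
        using less.hyps[of "par v"] par[OF v] parv[OF v] by (meson converse_rtrancl_into_rtrancl)
    qed auto
  qed
  have "sym (adj T')" by (auto simp: sym_def adj_def insert_commute)
  then have conn'': "(u, v) \<in> (adj T')\<^sup>*" if "u \<in> verts T" "v \<in> verts T" for u v
    using conn' that by (meson rtrancl_trans symE sym_rtrancl)
  have "inj_on b (verts T - {r})"
  proof (rule inj_onI)
    fix u v assume uv: "u \<in> verts T - {r}" "v \<in> verts T - {r}" "b u = b v"
    show "u = v"
      using par[OF uv(1)] par[OF uv(2)] uv(3)
      by (auto simp: b_def doubleton_eq_iff)
  qed
  moreover have "e \<in> b ` (verts T - {r})" if e: "e \<in> edges T" for e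
  proof (rule ccontr)
    assume no: "e \<notin> b ` (verts T - {r})"
    obtain u v where uv: "e = {u, v}" "u \<noteq> v" "u \<in> verts T" "v \<in> verts T"
      using e simple unfolding simple_graph_def by (metis card_2_iff insert_subset)
    \<comment> \<open>An edge outside the parent edges closes a path of parent edges to a cycle.\<close>
    obtain p where p: "is_path T' p" "hd p = u" "last p = v"
      using rtrancl_adj_imp_is_path[OF conn''[OF uv(3,4)] _ simple'] uv by (auto simp: T'_def)
    have pT: "is_path T p"
    proof -
      have "{x, y} \<in> edges T" if "{x, y} \<in> edges T'" for x y
        using that par by (force simp: T'_def b_def)
      then show ?thesis
        using p(1) unfolding is_path_def by (auto simp: T'_def elim!: successively_mono)
    qed
    have "3 \<le> length p"
    proof (rule ccontr)
      assume "\<not> 3 \<le> length p"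
      then consider "p = []" | x where "p = [x]" | x y where "p = [x, y]"
        by (cases p rule: remdups_adj.cases) (auto simp: not_le less_Suc_eq)
      then show False
        using p uv no by cases (auto simp: is_path_def T'_def)
    qed
    then have "is_cycle T p"
      using pT p e uv by (auto simp: is_cycle_def insert_commute)
    then show False using nocyc by blast
  qed
  ultimately have "bij_betw b (verts T - {r}) (edges T)"
    using par by (auto simp: bij_betw_def b_def)
  then show ?thesis by (auto simp: b_def)
qed

lemma tree_card_verts:
  assumes T: "is_tree T"
  shows "card (verts T) = Suc (card (edges T))"
proof -
  obtain r where r: "r \<in> verts T" using T by (auto simp: is_tree_def)
  obtain b where "bij_betw b (verts T - {r}) (edges T)" using tree_parent_edges[OF T r] by blast
  then have "card (verts T - {r}) = card (edges T)" by (rule bij_betw_same_card)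
  moreover have "finite (verts T)" using T by (auto simp: is_tree_def simple_graph_def)
  ultimately show ?thesis using r by (metis card.remove)
qed

lemma finite_edges: "simple_graph T \<Longrightarrow> finite (edges T)"
  by (rule finite_subset[of _ "Pow (verts T)"]) (auto simp: simple_graph_def)

text \<open>
  By the clique-intersection property, the cliques that contain \<open>v\<close> induce a subtree, whose edges
  are the edges of \<open>J\<close> with \<open>v\<close> in their separator. A tree has one more vertex than it has edges.
\<close>

lemma junction_tree_card:
  assumes J: "junction_tree G J" and v: "v \<in> verts G"
  shows "card {C \<in> verts J. v \<in> C} = Suc (card {e \<in> edges J. v \<in> \<Inter>e})"
proof -
  define T where "T = ({C \<in> verts J. v \<in> C}, {e \<in> edges J. v \<in> \<Inter>e})"
  have tree: "is_tree J" and ci: "\<And>p C. is_path J p \<Longrightarrow> C \<in> set p \<Longrightarrow> hd p \<inter> last p \<subseteq> C"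
    using J by (auto simp: junction_tree_def)
  obtain H where H: "chordal_completion G H" "verts J = max_cliques H"
    using J by (auto simp: junction_tree_def)
  have simple: "simple_graph J" using tree by (auto simp: is_tree_def)
  have path_sub: "is_path J p" if "is_path T p" for p
    using that unfolding is_path_def T_def by (auto elim: successively_mono)
  have "verts T \<noteq> {}"
  proof -
    have fin: "finite (verts H)" and vH: "v \<in> verts H"
      using H v by (auto simp: chordal_completion_def simple_graph_def)
    define Cs where "Cs = {K. is_clique H K \<and> v \<in> K}"
    have "{v} \<in> Cs" using vH by (auto simp: Cs_def is_clique_def)
    moreover have "finite Cs"
      by (rule finite_subset[of _ "Pow (verts H)"]) (auto simp: Cs_def is_clique_def fin)
    ultimately obtain K where "K \<in> Cs" "\<forall>L\<in>Cs. K \<subseteq> L \<longrightarrow> L = K"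
      using finite_has_maximal[of Cs] by (metis empty_iff)
    then have "K \<in> max_cliques H" "v \<in> K" by (auto simp: Cs_def max_cliques_def)
    then show ?thesis by (auto simp: T_def H)
  qed
  moreover have "simple_graph T"
    using simple by (auto simp: simple_graph_def T_def)
  moreover have "\<exists>p. is_path T p \<and> hd p = A \<and> last p = B"
    if A: "A \<in> verts T" and B: "B \<in> verts T" for A B
  proof -
    obtain p where p: "is_path J p" "hd p = A" "last p = B"
      using tree A B unfolding is_tree_def T_def by (metis (no_types, lifting) fst_conv mem_Collect_eq)
    have vC: "v \<in> C" if "C \<in> set p" for C using ci[OF p(1) that] p A B by (auto simp: T_def)
    have "successively (\<lambda>u v. {u, v} \<in> edges T) p"
      using p(1) vC unfolding is_path_def T_def by (auto elim: successively_mono)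
    then have "is_path T p"
      using p(1) vC by (auto simp: is_path_def T_def)
    then show ?thesis using p by blast
  qed
  moreover have "\<not> is_cycle T p" for p
  proof
    assume "is_cycle T p"
    then have "is_cycle J p" using path_sub by (auto simp: is_cycle_def T_def)
    then show False using tree by (auto simp: is_tree_def)
  qed
  ultimately have "is_tree T" by (auto simp: is_tree_def)
  from tree_card_verts[OF this] show ?thesis by (simp add: T_def)
qed

lemma sum_card_eq_sum_multiplicity:
  assumes "finite F" "finite X" "\<And>i. i \<in> F \<Longrightarrow> h i \<subseteq> X"
  shows "(\<Sum>i\<in>F. card (h i)) = (\<Sum>v\<in>X. card {i \<in> F. v \<in> h i})"
proof -
  have "(\<Sum>i\<in>F. card (h i)) = (\<Sum>i\<in>F. \<Sum>v\<in>X. of_bool (v \<in> h i))"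
    using assms by (intro sum.cong) (auto simp: Int_absorb1 Int_commute)
  also have "\<dots> = (\<Sum>v\<in>X. \<Sum>i\<in>F. of_bool (v \<in> h i))" by (rule sum.swap)
  also have "\<dots> = (\<Sum>v\<in>X. card {i \<in> F. v \<in> h i})"
    using assms(1) by (intro sum.cong) (auto simp: Int_def)
  finally show ?thesis .
qed

lemma junction_tree_vertex_subset:
  assumes "junction_tree G J" "C \<in> verts J"
  shows "C \<subseteq> verts G"
  using assms by (auto simp: junction_tree_def chordal_completion_def max_cliques_def is_clique_def)

lemma junction_tree_antichain:
  assumes "junction_tree G J" "A \<in> verts J" "B \<in> verts J" "A \<subseteq> B"
  shows "A = B"
  using assms by (auto simp: junction_tree_def max_cliques_def)

lemma junction_tree_sum_card:
  assumes J: "junction_tree G J" and fin: "finite (verts G)"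
  shows "(\<Sum>C\<in>verts J. card C) = card (verts G) + (\<Sum>e\<in>edges J. card (\<Inter>e))"
proof -
  have simple: "simple_graph J" using J by (auto simp: junction_tree_def is_tree_def)
  have fV: "finite (verts J)" and fE: "finite (edges J)"
    using simple finite_edges[OF simple] by (auto simp: simple_graph_def)
  have sub: "\<Inter>e \<subseteq> verts G" if "e \<in> edges J" for e
  proof -
    have "e \<subseteq> verts J" "e \<noteq> {}" using simple that by (auto simp: simple_graph_def)
    then show ?thesis using junction_tree_vertex_subset[OF J] by blast
  qed
  have "(\<Sum>C\<in>verts J. card C) = (\<Sum>v\<in>verts G. card {C \<in> verts J. v \<in> C})"
    by (rule sum_card_eq_sum_multiplicity[OF fV fin junction_tree_vertex_subset[OF J]])
  also have "\<dots> = (\<Sum>v\<in>verts G. Suc (card {e \<in> edges J. v \<in> \<Inter>e}))"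
    using junction_tree_card[OF J] by (intro sum.cong) auto
  also have "\<dots> = card (verts G) + (\<Sum>v\<in>verts G. card {e \<in> edges J. v \<in> \<Inter>e})"
    by (simp add: sum.distrib sum_Suc)
  also have "\<dots> = card (verts G) + (\<Sum>e\<in>edges J. card (\<Inter>e))"
    using sum_card_eq_sum_multiplicity[OF fE fin sub] by simp
  finally show ?thesis .
qed

section \<open>Polynomials of bounded degree in each variable\<close>

lemma tensor_polys_monomial:
  assumes "finite D" "\<alpha> \<in> (\<Pi>\<^sub>E k\<in>D. {..n})"
  shows "(\<lambda>x. \<Prod>k\<in>D. x k ^ \<alpha> k) \<in> tensor_polys D n"
proof -
  have fin: "finite (\<Pi>\<^sub>E k\<in>D. {..n::nat})" using assms(1) by (simp add: finite_PiE)
  have "(\<Prod>k\<in>D. x k ^ \<alpha> k)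
      = (\<Sum>\<beta>\<in>(\<Pi>\<^sub>E k\<in>D. {..n}). of_bool (\<beta> = \<alpha>) * (\<Prod>k\<in>D. x k ^ \<beta> k))" for x :: "nat \<Rightarrow> real"
    using assms(2) fin
    by (subst sum.mono_neutral_right[of _ "{\<alpha>}"]) auto
  then show ?thesis
    unfolding tensor_polys_def by (intro CollectI exI[of _ "\<lambda>\<beta>. of_bool (\<beta> = \<alpha>)"]) auto
qed

lemma tensor_polys_add:
  assumes "p \<in> tensor_polys D n" "q \<in> tensor_polys D n"
  shows "(\<lambda>x. p x + q x) \<in> tensor_polys D n"
proof -
  obtain c c' where "p = (\<lambda>x. \<Sum>\<alpha>\<in>(\<Pi>\<^sub>E k\<in>D. {..n}). c \<alpha> * (\<Prod>k\<in>D. x k ^ \<alpha> k))"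
    "q = (\<lambda>x. \<Sum>\<alpha>\<in>(\<Pi>\<^sub>E k\<in>D. {..n}). c' \<alpha> * (\<Prod>k\<in>D. x k ^ \<alpha> k))"
    using assms by (auto simp: tensor_polys_def)
  then show ?thesis
    unfolding tensor_polys_def
    by (intro CollectI exI[of _ "\<lambda>\<alpha>. c \<alpha> + c' \<alpha>"]) (simp add: sum.distrib distrib_right)
qed

lemma tensor_polys_scale:
  assumes "p \<in> tensor_polys D n"
  shows "(\<lambda>x. a * p x) \<in> tensor_polys D n"
proof -
  obtain c where "p = (\<lambda>x. \<Sum>\<alpha>\<in>(\<Pi>\<^sub>E k\<in>D. {..n}). c \<alpha> * (\<Prod>k\<in>D. x k ^ \<alpha> k))"
    using assms by (auto simp: tensor_polys_def)
  then show ?thesis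
    unfolding tensor_polys_def
    by (intro CollectI exI[of _ "\<lambda>\<alpha>. a * c \<alpha>"]) (simp add: sum_distrib_left mult.assoc)
qed

lemma tensor_polys_sum:
  assumes "\<And>i. i \<in> F \<Longrightarrow> p i \<in> tensor_polys D n"
  shows "(\<lambda>x. \<Sum>i\<in>F. p i x) \<in> tensor_polys D n"
proof -
  have zero: "(\<lambda>_. 0) \<in> tensor_polys D n"
    unfolding tensor_polys_def by (intro CollectI exI[of _ "\<lambda>_. 0"]) simp
  show ?thesis
    using assms by (induction F rule: infinite_finite_induct) (auto intro: zero tensor_polys_add)
qed

lemma tensor_polys_cases:
  assumes "p \<in> tensor_polys D n"
  obtains c where "p = (\<lambda>x. \<Sum>\<alpha>\<in>(\<Pi>\<^sub>E k\<in>D. {..n}). c \<alpha> * (\<Prod>k\<in>D. x k ^ \<alpha> k))"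
  using assms by (auto simp: tensor_polys_def)

lemma tensor_polys_mono:
  assumes "finite A" "S \<subseteq> A" "m \<le> n"
  shows "tensor_polys S m \<subseteq> tensor_polys A n"
proof
  fix p assume "p \<in> tensor_polys S m"
  then obtain c where p: "p = (\<lambda>x. \<Sum>\<alpha>\<in>(\<Pi>\<^sub>E k\<in>S. {..m}). c \<alpha> * (\<Prod>k\<in>S. x k ^ \<alpha> k))"
    by (rule tensor_polys_cases)
  have "(\<lambda>x. \<Prod>k\<in>S. x k ^ \<alpha> k) \<in> tensor_polys A n" if \<alpha>: "\<alpha> \<in> (\<Pi>\<^sub>E k\<in>S. {..m})" for \<alpha>
  proof -
    define \<beta> where "\<beta> = (\<lambda>k\<in>A. if k \<in> S then \<alpha> k else 0)"
    have "\<beta> \<in> (\<Pi>\<^sub>E k\<in>A. {..n})" using \<alpha> assms by (auto simp: \<beta>_def PiE_iff dest!: bspec)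
    moreover have "(\<Prod>k\<in>S. x k ^ \<alpha> k) = (\<Prod>k\<in>A. x k ^ \<beta> k)" for x :: "nat \<Rightarrow> real"
      by (rule prod.mono_neutral_cong_left) (use assms in \<open>auto simp: \<beta>_def subset_iff\<close>)
    ultimately show ?thesis using tensor_polys_monomial[OF assms(1)] by simp
  qed
  then show "p \<in> tensor_polys A n"
    unfolding p by (intro tensor_polys_sum tensor_polys_scale)
qed

lemma tensor_polys_const:
  assumes "finite D"
  shows "(\<lambda>_. a) \<in> tensor_polys D n"
  using tensor_polys_scale[OF tensor_polys_monomial[OF assms, of "\<lambda>k\<in>D. 0" n], of a] by simp

lemma tensor_polys_coord:
  assumes "finite D" "k \<in> D"
  shows "(\<lambda>x. x k) \<in> tensor_polys D 1"
proof -
  have "(\<Prod>i\<in>D. x i ^ (\<lambda>i\<in>D. of_bool (i = k)) i) = x k" for x :: "nat \<Rightarrow> real"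
    using assms by (subst prod.mono_neutral_right[of _ "{k}"]) auto
  then show ?thesis
    using tensor_polys_monomial[OF assms(1), of "\<lambda>i\<in>D. of_bool (i = k)" 1] by simp
qed

lemma tensor_polys_mult:
  assumes D: "finite D" and p: "p \<in> tensor_polys D m" and q: "q \<in> tensor_polys D n"
  shows "(\<lambda>x. p x * q x) \<in> tensor_polys D (m + n)"
proof -
  obtain c where c: "p = (\<lambda>x. \<Sum>\<alpha>\<in>(\<Pi>\<^sub>E k\<in>D. {..m}). c \<alpha> * (\<Prod>k\<in>D. x k ^ \<alpha> k))"
    using p by (rule tensor_polys_cases)
  obtain e where e: "q = (\<lambda>x. \<Sum>\<beta>\<in>(\<Pi>\<^sub>E k\<in>D. {..n}). e \<beta> * (\<Prod>k\<in>D. x k ^ \<beta> k))"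
    using q by (rule tensor_polys_cases)
  have mon: "(\<lambda>x. (\<Prod>k\<in>D. x k ^ \<alpha> k) * (\<Prod>k\<in>D. x k ^ \<beta> k)) \<in> tensor_polys D (m + n)"
    if "\<alpha> \<in> (\<Pi>\<^sub>E k\<in>D. {..m})" "\<beta> \<in> (\<Pi>\<^sub>E k\<in>D. {..n})" for \<alpha> \<beta>
  proof -
    have "(\<lambda>k\<in>D. \<alpha> k + \<beta> k) \<in> (\<Pi>\<^sub>E k\<in>D. {..m + n})" using that by (auto simp: PiE_iff add_mono)
    from tensor_polys_monomial[OF D this] show ?thesis by (simp add: power_add prod.distrib)
  qed
  have "(\<lambda>x. p x * q x) = (\<lambda>x. \<Sum>\<alpha>\<in>(\<Pi>\<^sub>E k\<in>D. {..m}). \<Sum>\<beta>\<in>(\<Pi>\<^sub>E k\<in>D. {..n}).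
      (c \<alpha> * e \<beta>) * ((\<Prod>k\<in>D. x k ^ \<alpha> k) * (\<Prod>k\<in>D. x k ^ \<beta> k)))"
    by (simp add: c e sum_product mult_ac)
  then show ?thesis using mon by (auto intro!: tensor_polys_sum tensor_polys_scale)
qed

text \<open>
  A polynomial does not see the coordinates outside \<open>S\<close>. Hence integrals with respect to different
  marginals can all be taken with respect to the measure on the full space.
\<close>

lemma tensor_polys_restrict:
  assumes "p \<in> tensor_polys S n" "S \<subseteq> A"
  shows "p (restrict x A) = p x"
proof -
  obtain c where "p = (\<lambda>x. \<Sum>\<alpha>\<in>(\<Pi>\<^sub>E k\<in>S. {..n}). c \<alpha> * (\<Prod>k\<in>S. x k ^ \<alpha> k))"
    using assms(1) by (rule tensor_polys_cases)
  then show ?thesis using assms(2) by (auto simp: subset_iff intro!: sum.cong prod.cong)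
qed

lemma tensor_polys_continuous:
  assumes "p \<in> tensor_polys D n"
  shows "continuous_on X p"
proof -
  obtain c where "p = (\<lambda>x. \<Sum>\<alpha>\<in>(\<Pi>\<^sub>E k\<in>D. {..n}). c \<alpha> * (\<Prod>k\<in>D. x k ^ \<alpha> k))"
    using assms by (rule tensor_polys_cases)
  then show ?thesis
    by (auto intro!: continuous_intros continuous_on_subset[OF continuous_on_product_coordinates])
qed

lemma tensor_polys_measurable:
  assumes "p \<in> tensor_polys D n"
  shows "p \<in> borel_measurable (leb D)"
proof -
  obtain c where "p = (\<lambda>x. \<Sum>\<alpha>\<in>(\<Pi>\<^sub>E k\<in>D. {..n}). c \<alpha> * (\<Prod>k\<in>D. x k ^ \<alpha> k))"
    using assms by (rule tensor_polys_cases)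
  moreover have "(\<lambda>x. \<Sum>\<alpha>\<in>(\<Pi>\<^sub>E k\<in>D. {..n}). c \<alpha> * (\<Prod>k\<in>D. x k ^ \<alpha> k)) \<in> borel_measurable (leb D)"
    unfolding leb_def
  proof (intro borel_measurable_sum borel_measurable_times borel_measurable_const
        borel_measurable_prod borel_measurable_power)
    show "(\<lambda>x. x k) \<in> borel_measurable (Pi\<^sub>M D (\<lambda>k. lborel))" if "k \<in> D" for k
      using measurable_component_singleton[OF that, of "\<lambda>_. lborel"] by simp
  qed
  ultimately show ?thesis by simp
qed

text \<open>
  This is the Stone-Weierstrass theorem. The coordinates in \<open>D\<close> separate the points of \<open>K\<close>, because
  functions in \<open>RA D\<close> agree outside \<open>D\<close>.
\<close>

lemma tensor_polys_dense:
  assumes D: "finite D" and K: "compact K" "K \<subseteq> RA D" and g: "continuous_on K g" and "0 < \<delta>"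
  obtains p n where "p \<in> tensor_polys D n" "\<And>x. x \<in> K \<Longrightarrow> \<bar>p x - g x\<bar> < \<delta>"
proof -
  interpret function_ring_on "\<Union>n. tensor_polys D n" K
  proof
    fix f g assume "f \<in> (\<Union>n. tensor_polys D n)" "g \<in> (\<Union>n. tensor_polys D n)"
    then obtain m n where fg: "f \<in> tensor_polys D m" "g \<in> tensor_polys D n" by auto
    show "(\<lambda>x. f x * g x) \<in> (\<Union>n. tensor_polys D n)" using tensor_polys_mult[OF D fg] by auto
    have "f \<in> tensor_polys D (max m n)" "g \<in> tensor_polys D (max m n)"
      using fg tensor_polys_mono[OF D order_refl, of m "max m n"]
        tensor_polys_mono[OF D order_refl, of n "max m n"] by auto
    then show "(\<lambda>x. f x + g x) \<in> (\<Union>n. tensor_polys D n)" using tensor_polys_add by blast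
  next
    fix x y assume xy: "x \<in> K" "y \<in> K" "x \<noteq> y"
    then obtain k where "k \<in> D" "x k \<noteq> y k"
    proof -
      have "x \<in> (\<Pi>\<^sub>E k\<in>D. UNIV)" "y \<in> (\<Pi>\<^sub>E k\<in>D. UNIV)" using xy K(2) by (auto simp: RA_def)
      then show ?thesis using xy(3) that PiE_ext[of x D _ y] by blast
    qed
    then show "\<exists>f\<in>\<Union>n. tensor_polys D n. f x \<noteq> f y"
      by (intro bexI[of _ "\<lambda>x. x k"]) (use tensor_polys_coord[OF D, of k] in auto)
  next
    show "continuous_on K f" if "f \<in> (\<Union>n. tensor_polys D n)" for f
      using that tensor_polys_continuous by auto
    show "(\<lambda>_. c) \<in> (\<Union>n. tensor_polys D n)" for c
      using tensor_polys_const[OF D] by auto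
  qed (rule K)
  obtain p where "p \<in> (\<Union>n. tensor_polys D n)" "\<forall>x\<in>K. \<bar>g x - p x\<bar> < \<delta>"
    using Stone_Weierstrass_basic[OF g \<open>0 < \<delta>\<close>] by blast
  then show ?thesis using that by (auto simp: abs_minus_commute)
qed

section \<open>Cubes\<close>

text \<open>
  The topology of \<open>\<real>\<^sup>D\<close> coincides with the one induced by the product topology on all functions, since
  elements of \<open>RA D\<close> have a fixed value outside \<open>D\<close>. This makes compactness and continuity with
  respect to the ambient type available.
\<close>

lemma RA_top_eq: "RA_top D = top_of_set (RA D)"
proof -
  have *: "top_of_set (RA D) = subtopology (product_topology (\<lambda>_. euclideanreal) UNIV) (RA D)"
    by (simp add: euclidean_product_topology)
  have ts: "topspace (RA_top D) = RA D" by (simp add: RA_top_def RA_def)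
  have 1: "continuous_map (RA_top D) (top_of_set (RA D)) (\<lambda>x. x)"
    unfolding * continuous_map_in_subtopology continuous_map_componentwise_UNIV
  proof (rule conjI, rule allI)
    show "(\<lambda>x. x) \<in> topspace (RA_top D) \<rightarrow> RA D" by (simp add: ts)
    fix k
    show "continuous_map (RA_top D) euclideanreal (\<lambda>x. x k)"
    proof (cases "k \<in> D")
      case True
      then show ?thesis unfolding RA_top_def by (rule continuous_map_product_projection)
    next
      case False
      have "continuous_map (RA_top D) euclideanreal (\<lambda>x. undefined)" by simp
      then show ?thesis
        by (rule continuous_map_eq) (use False in \<open>auto simp: ts RA_def PiE_iff extensional_def\<close>)
    qed
  qed
  have 2: "continuous_map (top_of_set (RA D)) (RA_top D) (\<lambda>x. x)"
    unfolding RA_top_def continuous_map_componentwise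
    by (auto simp: RA_def PiE_iff intro!: continuous_on_subset[OF continuous_on_product_coordinates])
  have "openin (RA_top D) U \<longleftrightarrow> openin (top_of_set (RA D)) U" for U
  proof
    assume "openin (RA_top D) U"
    moreover from this have "U \<subseteq> RA D" using openin_subset ts by blast
    then have "{x \<in> RA D. x \<in> U} = U" by auto
    ultimately show "openin (top_of_set (RA D)) U" using 2 by (auto simp: continuous_map_def)
  next
    assume "openin (top_of_set (RA D)) U"
    moreover from this have "U \<subseteq> RA D" using openin_subset by fastforce
    then have "{x \<in> RA D. x \<in> U} = U" by auto
    ultimately show "openin (RA_top D) U" using 1 by (auto simp: continuous_map_def ts)
  qed
  then show ?thesis by (simp add: topology_eq)
qed

definition open_cube :: "nat set \<Rightarrow> (nat \<Rightarrow> real) \<Rightarrow> real \<Rightarrow> (nat \<Rightarrow> real) set" where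
  "open_cube D z \<epsilon> = {x \<in> RA D. \<forall>k\<in>D. \<bar>x k - z k\<bar> < \<epsilon> / 2}"

lemma space_leb: "space (leb D) = RA D"
  by (simp add: leb_def space_PiM RA_def)

lemma B_inf_eq_PiE: "B_inf D z \<epsilon> = (\<Pi>\<^sub>E k\<in>D. {z k - \<epsilon> / 2..z k + \<epsilon> / 2})"
proof -
  have "\<bar>a - b\<bar> \<le> \<epsilon> / 2 \<longleftrightarrow> a \<in> {b - \<epsilon> / 2..b + \<epsilon> / 2}" for a b \<epsilon> :: real
    unfolding atLeastAtMost_iff abs_le_iff by linarith
  note eq = this
  show ?thesis
    by (intro set_eqI, unfold B_inf_def RA_def PiE_iff mem_Collect_eq eq) (auto simp del: atLeastAtMost_iff)
qed

lemma open_cube_eq_PiE: "open_cube D z \<epsilon> = (\<Pi>\<^sub>E k\<in>D. {z k - \<epsilon> / 2<..<z k + \<epsilon> / 2})"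
proof -
  have "\<bar>a - b\<bar> < \<epsilon> / 2 \<longleftrightarrow> a \<in> {b - \<epsilon> / 2<..<b + \<epsilon> / 2}" for a b \<epsilon> :: real
    unfolding greaterThanLessThan_iff abs_less_iff by linarith
  note eq = this
  show ?thesis
    by (intro set_eqI, unfold open_cube_def RA_def PiE_iff mem_Collect_eq eq) (auto simp del: greaterThanLessThan_iff)
qed

lemma B_inf_restrict: "B_inf D (restrict z D) \<epsilon> = B_inf D z \<epsilon>"
  by (auto simp: B_inf_def)

lemma open_cube_subset: "open_cube D z \<epsilon> \<subseteq> B_inf D z \<epsilon>"
  unfolding open_cube_def B_inf_def using less_imp_le by blast

lemma open_cube_subset_RA: "open_cube D z \<epsilon> \<subseteq> RA D"
  by (auto simp: open_cube_def)

lemma restrict_mem_open_cube: "0 < \<epsilon> \<Longrightarrow> restrict z D \<in> open_cube D z \<epsilon>"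
  by (auto simp: open_cube_def RA_def)

lemma product_sigma_finite_lborel: "product_sigma_finite (\<lambda>_::nat. lborel :: real measure)"
  by standard

lemma finite_cube_measurable:
  assumes "finite D"
  shows B_inf_sets: "B_inf D z \<epsilon> \<in> sets (leb D)" and open_cube_sets: "open_cube D z \<epsilon> \<in> sets (leb D)"
  unfolding B_inf_eq_PiE open_cube_eq_PiE leb_def using assms by (intro sets_PiM_I_finite; simp)+

lemma emeasure_cube:
  assumes D: "finite D" and e: "0 < \<epsilon>"
  shows emeasure_B_inf: "emeasure (leb D) (B_inf D z \<epsilon>) = ennreal (\<epsilon> ^ card D)"
    and emeasure_open_cube: "emeasure (leb D) (open_cube D z \<epsilon>) = ennreal (\<epsilon> ^ card D)"
proof -
  interpret product_sigma_finite "\<lambda>_::nat. lborel :: real measure" by (rule product_sigma_finite_lborel)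
  show "emeasure (leb D) (B_inf D z \<epsilon>) = ennreal (\<epsilon> ^ card D)"
    unfolding B_inf_eq_PiE leb_def using D e by (subst emeasure_PiM) (auto simp: ennreal_power)
  show "emeasure (leb D) (open_cube D z \<epsilon>) = ennreal (\<epsilon> ^ card D)"
    unfolding open_cube_eq_PiE leb_def using D e by (subst emeasure_PiM) (auto simp: ennreal_power)
qed

text \<open>
  The density is controlled only on the open cube, whereas the mean is taken over the closed one.
  They have the same volume.
\<close>

lemma AE_B_inf_iff_open_cube:
  assumes D: "finite D" and e: "0 < \<epsilon>"
  shows "AE x in leb D. x \<in> B_inf D z \<epsilon> \<longleftrightarrow> x \<in> open_cube D z \<epsilon>"
proof -
  have "emeasure (leb D) (B_inf D z \<epsilon> - open_cube D z \<epsilon>) = 0"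
    using emeasure_cube[OF D e, of z]
    by (subst emeasure_Diff) (auto simp: B_inf_sets open_cube_sets D open_cube_subset)
  then have "B_inf D z \<epsilon> - open_cube D z \<epsilon> \<in> null_sets (leb D)"
    using D by (auto simp: null_sets_def B_inf_sets open_cube_sets)
  then have "AE x in leb D. x \<notin> B_inf D z \<epsilon> - open_cube D z \<epsilon>" by (rule AE_not_in)
  then show ?thesis by eventually_elim (use open_cube_subset in blast)
qed

lemma openin_open_cube: 
  assumes "finite D"
  shows "openin (top_of_set (RA D)) (open_cube D z \<epsilon>)"
proof -
  have "open (\<Inter>k\<in>D. (\<lambda>x. \<bar>x k - z k\<bar>) -` {..<\<epsilon> / 2})"
    using assms by (intro open_INT ballI open_vimage open_lessThan)
      (auto intro!: continuous_intros continuous_on_product_coordinates)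
  moreover have "open_cube D z \<epsilon> = RA D \<inter> (\<Inter>k\<in>D. (\<lambda>x. \<bar>x k - z k\<bar>) -` {..<\<epsilon> / 2})"
    by (auto simp: open_cube_def)
  ultimately show ?thesis by (simp add: openin_open_Int)
qed

text \<open>
  The segment from \<open>a\<close> to \<open>b\<close>, formed within \<open>RA D\<close>, reduces the claim to the intermediate value
  theorem on \<open>{0..1}\<close>.
\<close>

lemma open_cube_IVT:
  fixes h :: "(nat \<Rightarrow> real) \<Rightarrow> real"
  assumes h: "continuous_on (open_cube D z \<epsilon>) h"
    and a: "a \<in> open_cube D z \<epsilon>" "h a \<le> c" and b: "b \<in> open_cube D z \<epsilon>" "c \<le> h b"
  shows "\<exists>\<zeta>\<in>open_cube D z \<epsilon>. h \<zeta> = c"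
proof -
  define \<gamma> where "\<gamma> t = (\<lambda>k\<in>D. (1 - t) * a k + t * b k)" for t :: real
  have in_cube: "\<gamma> t \<in> open_cube D z \<epsilon>" if t: "0 \<le> t" "t \<le> 1" for t
  proof -
    have "\<gamma> t k \<in> {z k - \<epsilon> / 2<..<z k + \<epsilon> / 2}" if "k \<in> D" for k
    proof -
      have "a k \<in> {z k - \<epsilon> / 2<..<z k + \<epsilon> / 2}" "b k \<in> {z k - \<epsilon> / 2<..<z k + \<epsilon> / 2}"
        using a(1) b(1) that by (auto simp: open_cube_eq_PiE simp del: greaterThanLessThan_iff)
      then show ?thesis
        using convexD[of "{z k - \<epsilon> / 2<..<z k + \<epsilon> / 2}" "a k" "b k" "1 - t" t] t that
        by (simp add: \<gamma>_def)
    qed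
    then show ?thesis unfolding open_cube_eq_PiE by (intro PiE_I) (simp_all add: \<gamma>_def)
  qed
  have \<gamma>: "continuous_on {0..1} \<gamma>"
  proof (rule continuous_on_coordinatewise_then_product)
    fix k show "continuous_on {0..1} (\<lambda>t. \<gamma> t k)"
      by (cases "k \<in> D") (auto simp: \<gamma>_def intro!: continuous_intros)
  qed
  have "continuous_on {0..1} (\<lambda>t. h (\<gamma> t))"
    by (rule continuous_on_compose2[OF h \<gamma>]) (use in_cube in auto)
  moreover have "\<gamma> 0 = a" "\<gamma> 1 = b"
    using a b by (auto simp: \<gamma>_def open_cube_def RA_def PiE_iff extensional_def)
  ultimately obtain t where "0 \<le> t" "t \<le> 1" "h (\<gamma> t) = c"
    using IVT'[of "\<lambda>t. h (\<gamma> t)" 0 c 1] a b by auto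
  then show ?thesis using in_cube by auto
qed

text \<open>
  These continuous functions increase to the indicator of the open cube. Subtracting 1 before
  truncating makes each of them vanish on a neighbourhood of the boundary, and not merely on the
  boundary itself: the product with a function that blows up at the boundary is then still
  continuous.
\<close>

definition cutoff :: "nat set \<Rightarrow> (nat \<Rightarrow> real) \<Rightarrow> real \<Rightarrow> nat \<Rightarrow> (nat \<Rightarrow> real) \<Rightarrow> real" where
  "cutoff D z \<epsilon> j x = min 1 (max 0 (real j * (\<Prod>k\<in>D. max 0 (\<epsilon> / 2 - \<bar>x k - z k\<bar>)) - 1))"

lemma cutoff_bounds: "0 \<le> cutoff D z \<epsilon> j x" "cutoff D z \<epsilon> j x \<le> 1"
  by (auto simp: cutoff_def)

lemma continuous_on_cutoff: "continuous_on X (cutoff D z \<epsilon> j)"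
  unfolding cutoff_def
  by (intro continuous_on_min continuous_on_mult continuous_on_const continuous_on_prod
      continuous_on_max continuous_on_diff continuous_on_rabs
      continuous_on_subset[OF continuous_on_product_coordinates subset_UNIV])

lemma cutoff_measurable: "cutoff D z \<epsilon> j \<in> borel_measurable (leb D)"
proof -
  have [measurable]: "(\<lambda>x. x k) \<in> borel_measurable (leb D)" if "k \<in> D" for k
    unfolding leb_def using measurable_component_singleton[OF that, of "\<lambda>_. lborel"] by simp
  show ?thesis unfolding cutoff_def by measurable
qed

lemma cutoff_outside:
  assumes "finite D" "x \<in> RA D" "x \<notin> open_cube D z \<epsilon>"
  shows "cutoff D z \<epsilon> j x = 0"
proof -
  obtain k where "k \<in> D" "\<epsilon> / 2 \<le> \<bar>x k - z k\<bar>" using assms by (force simp: open_cube_def)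
  then have "(\<Prod>k\<in>D. max 0 (\<epsilon> / 2 - \<bar>x k - z k\<bar>)) = 0" using assms(1) by (auto intro!: bexI[of _ k])
  then show ?thesis by (simp add: cutoff_def)
qed

lemma cutoff_tendsto_1:
  assumes "x \<in> open_cube D z \<epsilon>"
  shows "(\<lambda>j. cutoff D z \<epsilon> j x) \<longlonglongrightarrow> 1"
proof -
  define r where "r = (\<Prod>k\<in>D. max 0 (\<epsilon> / 2 - \<bar>x k - z k\<bar>))"
  have "0 < r" unfolding r_def using assms by (intro prod_pos) (force simp: open_cube_def)
  then obtain N :: nat where N: "2 < real N * r" using ex_less_of_nat_mult by blast
  have "cutoff D z \<epsilon> j x = 1" if "N \<le> j" for j
  proof -
    have "real N * r \<le> real j * r" using that \<open>0 < r\<close> by simp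
    then show ?thesis using N by (simp add: cutoff_def flip: r_def)
  qed
  then show ?thesis by (intro tendsto_eventually) (auto simp: eventually_sequentially)
qed

text \<open>
  \<open>RA D\<close> is the union of two relatively open sets: the open cube, where both factors are continuous,
  and a set that contains the complement of the cube, where the cutoff vanishes.
\<close>

lemma continuous_on_cutoff_mult:
  assumes D: "finite D" and h: "continuous_on (open_cube D z \<epsilon>) h"
  shows "continuous_on (RA D) (\<lambda>x. cutoff D z \<epsilon> j x * h x)"
proof -
  define V where "V = RA D \<inter> (\<lambda>x. real j * (\<Prod>k\<in>D. max 0 (\<epsilon> / 2 - \<bar>x k - z k\<bar>))) -` {..<1}"
  have "open ((\<lambda>x. real j * (\<Prod>k\<in>D. max 0 (\<epsilon> / 2 - \<bar>x k - z k\<bar>))) -` {..<1})"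
    by (intro open_vimage open_lessThan continuous_on_mult continuous_on_const continuous_on_prod
        continuous_on_max continuous_on_diff continuous_on_rabs continuous_on_product_coordinates)
  then have V: "openin (top_of_set (RA D)) V" unfolding V_def by (rule openin_open_Int)
  have O: "openin (top_of_set (RA D)) (open_cube D z \<epsilon>)" by (rule openin_open_cube[OF D])
  have un: "RA D = open_cube D z \<epsilon> \<union> V"
  proof -
    have "x \<in> V" if x: "x \<in> RA D" "x \<notin> open_cube D z \<epsilon>" for x
    proof -
      obtain k where "k \<in> D" "\<epsilon> / 2 \<le> \<bar>x k - z k\<bar>" using x by (force simp: open_cube_def)
      then have "(\<Prod>k\<in>D. max 0 (\<epsilon> / 2 - \<bar>x k - z k\<bar>)) = 0" using D by (auto intro!: bexI[of _ k])
      then show ?thesis using x by (simp add: V_def)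
    qed
    moreover have "V \<subseteq> RA D" by (simp add: V_def)
    ultimately show ?thesis using open_cube_subset_RA by blast
  qed
  have "continuous_on V (\<lambda>x. cutoff D z \<epsilon> j x * h x)"
    by (rule continuous_on_eq[OF continuous_on_const[of _ 0]]) (auto simp: V_def cutoff_def)
  moreover have "continuous_on (open_cube D z \<epsilon>) (\<lambda>x. cutoff D z \<epsilon> j x * h x)"
    by (intro continuous_on_mult continuous_on_cutoff h)
  ultimately have "continuous_on (open_cube D z \<epsilon> \<union> V) (\<lambda>x. cutoff D z \<epsilon> j x * h x)"
    using O V unfolding un by (intro continuous_on_Un_local_open) (simp_all flip: un)
  then show ?thesis by (simp flip: un)
qed

text \<open>
  The integrand over the cube is a product of functions of one variable each. The variables in
  \<open>A - S\<close> contribute the mean of the constant 1 over an interval of length \<open>\<epsilon>\<close>, so that the mean does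
  not depend on \<open>A\<close>.
\<close>

lemma cube_average_monomial:
  assumes A: "finite A" "S \<subseteq> A" and e: "0 < \<epsilon>"
  shows "integrable (leb A) (\<lambda>x. indicator (B_inf A z \<epsilon>) x * (\<Prod>k\<in>S. x k ^ \<alpha> k))"
    and "(LINT x:B_inf A z \<epsilon>|leb A. (\<Prod>k\<in>S. x k ^ \<alpha> k) / \<epsilon> ^ card A)
      = (\<Prod>k\<in>S. LINT t|lborel. indicator {z k - \<epsilon> / 2..z k + \<epsilon> / 2} t * t ^ \<alpha> k / \<epsilon>)"
proof -
  interpret product_sigma_finite "\<lambda>_::nat. lborel :: real measure" by (rule product_sigma_finite_lborel)
  \<comment> \<open>The exponent 0 for coordinates outside \<open>S\<close> turns the integrand into a product over all of \<open>A\<close>.\<close>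
  define \<phi> where "\<phi> k t = indicator {z k - \<epsilon> / 2..z k + \<epsilon> / 2} t * t ^ (if k \<in> S then \<alpha> k else 0) / \<epsilon>" for k t
  have int: "integrable lborel (\<phi> k)" for k
  proof -
    have "integrable lborel (\<lambda>t. indicator {z k - \<epsilon> / 2..z k + \<epsilon> / 2} t *\<^sub>R (t ^ (if k \<in> S then \<alpha> k else 0)))"
      by (intro borel_integrable_compact continuous_intros) auto
    then show ?thesis unfolding \<phi>_def by simp
  qed
  have eq: "indicator (B_inf A z \<epsilon>) x * (\<Prod>k\<in>S. x k ^ \<alpha> k) / \<epsilon> ^ card A = (\<Prod>k\<in>A. \<phi> k (x k))"
    if x: "x \<in> space (leb A)" for x
  proof (cases "x \<in> B_inf A z \<epsilon>")
    case True
    have "(\<Prod>k\<in>A. \<phi> k (x k)) = (\<Prod>k\<in>A. x k ^ (if k \<in> S then \<alpha> k else 0) / \<epsilon>)"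
    proof (rule prod.cong[OF refl])
      fix k assume "k \<in> A"
      then have "x k \<in> {z k - \<epsilon> / 2..z k + \<epsilon> / 2}" using True unfolding B_inf_eq_PiE by (rule PiE_mem[rotated])
      then show "\<phi> k (x k) = x k ^ (if k \<in> S then \<alpha> k else 0) / \<epsilon>" by (simp only: \<phi>_def indicator_simps mult_1)
    qed
    also have "\<dots> = (\<Prod>k\<in>A. x k ^ (if k \<in> S then \<alpha> k else 0)) / \<epsilon> ^ card A"
      by (simp add: prod_dividef)
    also have "(\<Prod>k\<in>A. x k ^ (if k \<in> S then \<alpha> k else 0)) = (\<Prod>k\<in>S. x k ^ \<alpha> k)"
      by (rule prod.mono_neutral_cong_right) (use A in auto)
    finally show ?thesis using True by simp
  next
    case False
    then obtain k where "k \<in> A" "x k \<notin> {z k - \<epsilon> / 2..z k + \<epsilon> / 2}"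
      using x by (auto simp: B_inf_eq_PiE space_leb RA_def PiE_iff)
    then have "\<phi> k (x k) = 0" unfolding \<phi>_def by (simp only: indicator_simps not_False_eq_True mult_zero_left div_0)
    then have "(\<Prod>k\<in>A. \<phi> k (x k)) = 0" using A(1) \<open>k \<in> A\<close> by (intro prod_zero) auto
    then show ?thesis using False by simp
  qed
  have "integrable (leb A) (\<lambda>x. \<Prod>k\<in>A. \<phi> k (x k))"
    unfolding leb_def by (rule product_integrable_prod[OF A(1) int])
  then have "integrable (leb A) (\<lambda>x. indicator (B_inf A z \<epsilon>) x * (\<Prod>k\<in>S. x k ^ \<alpha> k) / \<epsilon> ^ card A)"
    using eq by (simp cong: Bochner_Integration.integrable_cong)
  from integrable_mult_right[OF this, of "\<epsilon> ^ card A"]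
  show "integrable (leb A) (\<lambda>x. indicator (B_inf A z \<epsilon>) x * (\<Prod>k\<in>S. x k ^ \<alpha> k))"
    using e by simp
  have "(LINT x:B_inf A z \<epsilon>|leb A. (\<Prod>k\<in>S. x k ^ \<alpha> k) / \<epsilon> ^ card A) = (LINT x|leb A. (\<Prod>k\<in>A. \<phi> k (x k)))"
    unfolding set_lebesgue_integral_def using eq by (intro Bochner_Integration.integral_cong) auto
  also have "\<dots> = (\<Prod>k\<in>A. integral\<^sup>L lborel (\<phi> k))"
    unfolding leb_def by (rule product_integral_prod[OF A(1) int])
  also have "\<dots> = (\<Prod>k\<in>S. LINT t|lborel. indicator {z k - \<epsilon> / 2..z k + \<epsilon> / 2} t * t ^ \<alpha> k / \<epsilon>)"
    by (rule prod.mono_neutral_cong_right) (use A e in \<open>auto simp: \<phi>_def[abs_def]\<close>)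
  finally show "(LINT x:B_inf A z \<epsilon>|leb A. (\<Prod>k\<in>S. x k ^ \<alpha> k) / \<epsilon> ^ card A)
      = (\<Prod>k\<in>S. LINT t|lborel. indicator {z k - \<epsilon> / 2..z k + \<epsilon> / 2} t * t ^ \<alpha> k / \<epsilon>)" .
qed

lemma cube_average_tensor_poly:
  assumes A: "finite A" "S \<subseteq> A" and e: "0 < \<epsilon>" and p: "p \<in> tensor_polys S n"
  shows "(LINT x:B_inf A z \<epsilon>|leb A. p x / \<epsilon> ^ card A) = (LINT x:B_inf S z \<epsilon>|leb S. p x / \<epsilon> ^ card S)"
proof -
  obtain c where p: "p = (\<lambda>x. \<Sum>\<alpha>\<in>(\<Pi>\<^sub>E k\<in>S. {..n}). c \<alpha> * (\<Prod>k\<in>S. x k ^ \<alpha> k))"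
    using p by (rule tensor_polys_cases)
  have "(LINT x:B_inf B z \<epsilon>|leb B. p x / \<epsilon> ^ card B) = (\<Sum>\<alpha>\<in>(\<Pi>\<^sub>E k\<in>S. {..n}).
      c \<alpha> * (\<Prod>k\<in>S. LINT t|lborel. indicator {z k - \<epsilon> / 2..z k + \<epsilon> / 2} t * t ^ \<alpha> k / \<epsilon>))"
    if B: "finite B" "S \<subseteq> B" for B
  proof -
    note monom = cube_average_monomial[OF B e, of z]
    have "(LINT x:B_inf B z \<epsilon>|leb B. p x / \<epsilon> ^ card B) = (LINT x|leb B. (\<Sum>\<alpha>\<in>(\<Pi>\<^sub>E k\<in>S. {..n}).
        c \<alpha> * (indicator (B_inf B z \<epsilon>) x * (\<Prod>k\<in>S. x k ^ \<alpha> k) / \<epsilon> ^ card B)))"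
      unfolding set_lebesgue_integral_def p
      by (intro Bochner_Integration.integral_cong) (auto simp: sum_divide_distrib sum_distrib_left mult_ac)
    also have "\<dots> = (\<Sum>\<alpha>\<in>(\<Pi>\<^sub>E k\<in>S. {..n}).
        c \<alpha> * (LINT x|leb B. indicator (B_inf B z \<epsilon>) x * (\<Prod>k\<in>S. x k ^ \<alpha> k) / \<epsilon> ^ card B))"
      using monom(1) by (subst Bochner_Integration.integral_sum) auto
    finally have sum: "(LINT x:B_inf B z \<epsilon>|leb B. p x / \<epsilon> ^ card B) = (\<Sum>\<alpha>\<in>(\<Pi>\<^sub>E k\<in>S. {..n}).
        c \<alpha> * (LINT x|leb B. indicator (B_inf B z \<epsilon>) x * (\<Prod>k\<in>S. x k ^ \<alpha> k) / \<epsilon> ^ card B))" .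
    have "(LINT x|leb B. indicator (B_inf B z \<epsilon>) x * (\<Prod>k\<in>S. x k ^ \<alpha> k) / \<epsilon> ^ card B)
        = (\<Prod>k\<in>S. LINT t|lborel. indicator {z k - \<epsilon> / 2..z k + \<epsilon> / 2} t * t ^ \<alpha> k / \<epsilon>)" for \<alpha>
      using monom(2)[of \<alpha>] by (simp only: set_lebesgue_integral_def real_scaleR_def times_divide_eq_right)
    then show ?thesis by (simp only: sum)
  qed
  from this[OF A] this[OF finite_subset[OF A(2,1)] order_refl] show ?thesis by simp
qed

lemma cube_average_const:
  assumes "finite D" "0 < \<epsilon>"
  shows "(LINT y:B_inf D z \<epsilon>|leb D. a / \<epsilon> ^ card D) = a"
  using emeasure_B_inf[OF assms, of z] assms(2) B_inf_sets[OF assms(1), of z \<epsilon>]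
  by (simp add: set_lebesgue_integral_def measure_def)

section \<open>Marginals\<close>

lemma sigma_finite_leb: "finite D \<Longrightarrow> sigma_finite_measure (leb D)"
  unfolding leb_def by (rule product_sigma_finite.sigma_finite[OF product_sigma_finite_lborel])

lemma merge_measurable_leb:
  assumes "D \<subseteq> I" "f \<in> borel_measurable (leb I)"
  shows "(\<lambda>(x, y). f (merge D (I - D) (x, y))) \<in> borel_measurable (leb D \<Otimes>\<^sub>M leb (I - D))"
proof -
  have "merge D (I - D) \<in> leb D \<Otimes>\<^sub>M leb (I - D) \<rightarrow>\<^sub>M leb I"
    using measurable_merge[of D "I - D" "\<lambda>_. lborel"] assms(1)
    by (simp add: leb_def Un_absorb1 Diff_partition)
  then show ?thesis using measurable_compose[OF _ assms(2)] by (simp add: case_prod_unfold)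
qed

lemma marginal_density_measurable:
  assumes "D \<subseteq> {1..d}" "D \<noteq> {}" "f \<in> borel_measurable (leb {1..d})"
  shows "marginal_density d f D \<in> borel_measurable (leb D)"
proof -
  interpret sigma_finite_measure "leb ({1..d} - D)" by (rule sigma_finite_leb) simp
  have [measurable]:
    "(\<lambda>(x, y). f (merge D ({1..d} - D) (x, y))) \<in> borel_measurable (leb D \<Otimes>\<^sub>M leb ({1..d} - D))"
    by (rule merge_measurable_leb[OF assms(1,3)])
  have "(\<lambda>x. LINT y|leb ({1..d} - D). f (merge D ({1..d} - D) (x, y))) \<in> borel_measurable (leb D)"
    by (rule borel_measurable_lebesgue_integral) fact
  then show ?thesis using assms(2) by (simp add: marginal_density_def[abs_def])
qed

lemma merge_RA:
  assumes "D \<subseteq> I" "x \<in> RA D" "y \<in> RA (I - D)"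
  shows "merge D (I - D) (x, y) \<in> RA I"
  using assms by (auto simp: RA_def merge_def PiE_iff extensional_def)

lemma marginal_density_nonneg:
  assumes "D \<subseteq> {1..d}" "x \<in> RA D" "\<And>x. x \<in> RA {1..d} \<Longrightarrow> 0 \<le> f x"
  shows "0 \<le> marginal_density d f D x"
  using merge_RA[OF assms(1,2)] assms(3)
  by (auto simp: marginal_density_def space_leb intro!: integral_nonneg_AE AE_I2)

text \<open>
  This is Tonelli's theorem for the splitting of the coordinates into \<open>D\<close> and the rest. The function
  \<open>marginal_density\<close> is a Bochner integral, which is 0 for a section that is not integrable; almost
  every section is integrable because the iterated integral is finite.
\<close>

lemma marginal_eq_density:
  assumes prob: "prob_space \<mu>" and \<mu>: "\<mu> = density (leb {1..d}) (\<lambda>x. ennreal (f x))"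
    and f: "f \<in> borel_measurable (leb {1..d})" and f0: "\<And>x. x \<in> RA {1..d} \<Longrightarrow> 0 \<le> f x"
    and D: "D \<subseteq> {1..d}" "D \<noteq> {}"
  shows "marginal D \<mu> = density (leb D) (\<lambda>x. ennreal (marginal_density d f D x))"
proof -
  interpret product_sigma_finite "\<lambda>_::nat. lborel :: real measure" by (rule product_sigma_finite_lborel)
  define E where "E = {1..d} - D"
  have DE: "D \<inter> E = {}" "D \<union> E = {1..d}" and fin: "finite D" "finite E"
    using D by (auto simp: E_def intro: finite_subset)
  interpret E: sigma_finite_measure "leb E" using fin by (simp add: sigma_finite_leb)
  have fold: "(\<integral>\<^sup>+x. g x \<partial>leb {1..d}) = (\<integral>\<^sup>+x. (\<integral>\<^sup>+y. g (merge D E (x, y)) \<partial>leb E) \<partial>leb D)"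
    if "g \<in> borel_measurable (leb {1..d})" for g :: "_ \<Rightarrow> ennreal"
    using product_nn_integral_fold[OF DE(1) fin, of g] that DE by (simp add: leb_def)
  have fm[measurable]: "(\<lambda>(x, y). f (merge D E (x, y))) \<in> borel_measurable (leb D \<Otimes>\<^sub>M leb E)"
    unfolding E_def by (rule merge_measurable_leb[OF D(1) f])
  have restr[measurable]: "(\<lambda>x. restrict x D) \<in> leb {1..d} \<rightarrow>\<^sub>M leb D"
    unfolding leb_def by (rule measurable_restrict_subset[OF D(1)])
  have ind: "(\<lambda>x. indicator A (restrict x D) :: ennreal) \<in> borel_measurable (leb {1..d})"
    if "A \<in> sets (leb D)" for A
    by (rule measurable_compose[OF restr]) (use that in simp)
  have wm: "marginal_density d f D \<in> borel_measurable (leb D)"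
    by (rule marginal_density_measurable[OF D f])
  have "(\<integral>\<^sup>+x. f x \<partial>leb {1..d}) = 1"
  proof -
    have "emeasure \<mu> (space \<mu>) = 1" using prob by (rule prob_space.emeasure_space_1)
    then show ?thesis 
      using f by (simp add: \<mu> emeasure_density del: One_nat_def cong: nn_integral_cong)
  qed
  then have "(\<integral>\<^sup>+x. (\<integral>\<^sup>+y. f (merge D E (x, y)) \<partial>leb E) \<partial>leb D) \<noteq> \<infinity>"
    using fold[of f] f by simp
  \<comment> \<open>Sections with infinite integral form a null set; on the others both integrals agree.\<close>
  then have "AE x in leb D. (\<integral>\<^sup>+y. f (merge D E (x, y)) \<partial>leb E) \<noteq> \<infinity>"
    by (intro nn_integral_noteq_infinite) measurable
  moreover have "AE x in leb D. x \<in> RA D" by (simp add: space_leb[symmetric])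
  ultimately have AE_eq: "AE x in leb D. (\<integral>\<^sup>+y. f (merge D E (x, y)) \<partial>leb E) = ennreal (marginal_density d f D x)"
  proof eventually_elim
    case (elim x)
    have nn: "AE y in leb E. 0 \<le> f (merge D E (x, y))"
      using merge_RA[OF D(1) elim(2)] f0 by (auto simp: E_def space_leb intro!: AE_I2)
    have mx: "(\<lambda>y. f (merge D E (x, y))) \<in> borel_measurable (leb E)"
      using measurable_compose[OF measurable_Pair1' fm, of x] elim(2) by (simp add: space_leb)
    have "integrable (leb E) (\<lambda>y. f (merge D E (x, y)))"
      using elim(1) nn mx by (intro integrableI_nonneg) (auto simp: less_top)
    from nn_integral_eq_integral[OF this nn] show ?case
      using D(2) by (simp add: marginal_density_def E_def)
  qed
  show ?thesis
  proof (rule measure_eqI)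
    show "sets (marginal D \<mu>) = sets (density (leb D) (\<lambda>x. ennreal (marginal_density d f D x)))"
      by (simp add: marginal_def)
    fix A assume "A \<in> sets (marginal D \<mu>)"
    then have A[measurable]: "A \<in> sets (leb D)" by (simp add: marginal_def)
    have "emeasure (marginal D \<mu>) A = (\<integral>\<^sup>+x. ennreal (f x) * indicator A (restrict x D) \<partial>leb {1..d})"
    proof -
      have "emeasure (marginal D \<mu>) A = (\<integral>\<^sup>+x. indicator A x \<partial>marginal D \<mu>)"
        by (simp add: marginal_def)
      also have "\<dots> = (\<integral>\<^sup>+x. indicator A (restrict x D) \<partial>\<mu>)"
        unfolding marginal_def by (rule nn_integral_distr) (auto simp: \<mu> restr simp del: One_nat_def)
      also have "\<dots> = (\<integral>\<^sup>+x. ennreal (f x) * indicator A (restrict x D) \<partial>leb {1..d})"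
        unfolding \<mu> 
        by (intro nn_integral_density ind A measurable_compose[OF f measurable_ennreal])
      finally show ?thesis .
    qed
    also have "\<dots> = (\<integral>\<^sup>+x. (\<integral>\<^sup>+y. ennreal (f (merge D E (x, y))) * indicator A (restrict (merge D E (x, y)) D) \<partial>leb E) \<partial>leb D)"
      by (intro fold borel_measurable_times_ennreal ind A measurable_compose[OF f measurable_ennreal])
    also have "\<dots> = (\<integral>\<^sup>+x. (\<integral>\<^sup>+y. f (merge D E (x, y)) \<partial>leb E) * indicator A x \<partial>leb D)"
    proof (rule nn_integral_cong)
      fix x assume x: "x \<in> space (leb D)"
      then have "restrict (merge D E (x, y)) D = x" for y
        by (auto simp: space_leb RA_def merge_def fun_eq_iff PiE_iff extensional_def)
      moreover have "(\<lambda>y. f (merge D E (x, y))) \<in> borel_measurable (leb E)"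
        using measurable_compose[OF measurable_Pair1' fm, of x] x by simp
      ultimately show "(\<integral>\<^sup>+y. ennreal (f (merge D E (x, y))) * indicator A (restrict (merge D E (x, y)) D) \<partial>leb E)
          = (\<integral>\<^sup>+y. f (merge D E (x, y)) \<partial>leb E) * indicator A x"
        by (simp add: nn_integral_multc)
    qed
    also have "\<dots> = (\<integral>\<^sup>+x. ennreal (marginal_density d f D x) * indicator A x \<partial>leb D)"
      by (rule nn_integral_cong_AE) (use AE_eq in eventually_elim, simp)
    also have "\<dots> = emeasure (density (leb D) (\<lambda>x. ennreal (marginal_density d f D x))) A"
      using wm by (subst emeasure_density) auto
    finally show "emeasure (marginal D \<mu>) A = emeasure (density (leb D) (\<lambda>x. ennreal (marginal_density d f D x))) A" .
  qed
qed

lemma integral_marginal: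
  fixes p :: "(nat \<Rightarrow> real) \<Rightarrow> real"
  assumes D: "D \<subseteq> {1..d}" and \<mu>: "sets \<mu> = sets (leb {1..d})" and p: "p \<in> borel_measurable (leb D)"
  shows "(LINT x|marginal D \<mu>. p x) = (LINT x|\<mu>. p (restrict x D))"
proof -
  have "(\<lambda>x. restrict x D) \<in> \<mu> \<rightarrow>\<^sub>M leb D"
    unfolding measurable_cong_sets[OF \<mu> refl] leb_def by (rule measurable_restrict_subset[OF D])
  then show ?thesis unfolding marginal_def using p by (rule integral_distr)
qed

section \<open>The Christoffel minimum for one density\<close>

text \<open>
  One marginal at a time: \<open>w\<close> is its density and \<open>K\<close> the projection of the support. On the boundary of
  the cube nothing but nonnegativity is known about \<open>w\<close>.
\<close>

locale cube_in_support =
  fixes D :: "nat set" and z :: "nat \<Rightarrow> real" and \<epsilon> :: real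
    and w :: "(nat \<Rightarrow> real) \<Rightarrow> real" and K :: "(nat \<Rightarrow> real) set"
  assumes finite_D: "finite D" and eps_pos: "0 < \<epsilon>"
    and w_measurable: "w \<in> borel_measurable (leb D)"
    and w_nonneg: "\<And>x. x \<in> RA D \<Longrightarrow> 0 \<le> w x"
    and w_integrable: "integrable (leb D) w"
    and compact_K: "compact K" and K_subset: "K \<subseteq> RA D"
    and w_zero: "\<And>x. x \<in> RA D \<Longrightarrow> x \<notin> K \<Longrightarrow> w x = 0"
    and cube_subset_K: "B_inf D z \<epsilon> \<subseteq> K"
    and w_continuous: "continuous_on (open_cube D z \<epsilon>) w"
    and w_pos: "\<And>x. x \<in> open_cube D z \<epsilon> \<Longrightarrow> 0 < w x"
begin

definition avg :: "((nat \<Rightarrow> real) \<Rightarrow> real) \<Rightarrow> real" where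
  "avg p = (LINT y:B_inf D z \<epsilon>|leb D. p y / \<epsilon> ^ card D)"

definition energy :: "((nat \<Rightarrow> real) \<Rightarrow> real) \<Rightarrow> real" where
  "energy p = (LINT x|leb D. w x * (p x)\<^sup>2)"

definition min_energy :: "nat \<Rightarrow> real" where
  "min_energy n = christoffel_min D n (density (leb D) (\<lambda>x. ennreal (w x))) z \<epsilon>"

definition feasible :: "nat \<Rightarrow> ((nat \<Rightarrow> real) \<Rightarrow> real) set" where
  "feasible n = {p \<in> tensor_polys D n. avg p = 1}"

lemma AE_RA: "AE x in leb D. x \<in> RA D"
  by (simp add: space_leb[symmetric])

lemma w_AE_nonneg: "AE x in leb D. 0 \<le> w x"
  using AE_RA by eventually_elim (rule w_nonneg)

lemma sets_B_inf [measurable]: "B_inf D z \<epsilon> \<in> sets (leb D)"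
  and sets_open_cube [measurable]: "open_cube D z \<epsilon> \<in> sets (leb D)"
  using finite_D by (auto simp: B_inf_sets open_cube_sets)

lemma energy_nonneg: "0 \<le> energy p"
  unfolding energy_def using w_AE_nonneg by (intro integral_nonneg_AE) auto

lemma integral_eq_energy:
  assumes "p \<in> borel_measurable (leb D)"
  shows "(LINT x|density (leb D) (\<lambda>x. ennreal (w x)). (p x)\<^sup>2) = energy p"
  unfolding energy_def using assms w_measurable w_AE_nonneg by (subst integral_real_density) auto

lemma min_energy_eq_Inf: "min_energy n = Inf (energy ` feasible n)"
proof -
  have "{(LINT x|density (leb D) (\<lambda>x. ennreal (w x)). (p x)\<^sup>2) | p.
      p \<in> tensor_polys D n \<and> (LINT y:B_inf D z \<epsilon>|leb D. p y / \<epsilon> ^ card D) = 1} = energy ` feasible n"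
    unfolding setcompr_eq_image
    by (intro image_cong) (auto simp: feasible_def avg_def intro!: integral_eq_energy tensor_polys_measurable)
  then show ?thesis by (simp add: min_energy_def christoffel_min_def)
qed

lemma avg_const: "avg (\<lambda>_. a) = a"
  unfolding avg_def by (rule cube_average_const[OF finite_D eps_pos])

lemma avg_scale: "avg (\<lambda>x. a * p x) = a * avg p"
proof -
  have "indicator (B_inf D z \<epsilon>) x *\<^sub>R (a * p x / \<epsilon> ^ card D)
      = a * (indicator (B_inf D z \<epsilon>) x *\<^sub>R (p x / \<epsilon> ^ card D))" for x
    by (simp add: indicator_def)
  then show ?thesis
    unfolding avg_def set_lebesgue_integral_def by (simp only: integral_mult_right_zero)
qed

lemma energy_scale: "energy (\<lambda>x. a * p x) = a\<^sup>2 * energy p"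
proof -
  have "w x * (a * p x)\<^sup>2 = a\<^sup>2 * (w x * (p x)\<^sup>2)" for x by (simp add: power_mult_distrib)
  then show ?thesis unfolding energy_def by (simp only: integral_mult_right_zero)
qed

lemma one_feasible: "(\<lambda>_. 1) \<in> feasible n"
  by (simp add: feasible_def avg_const tensor_polys_const finite_D)

lemma bdd_below_energy: "bdd_below (energy ` F)"
  by (rule bdd_belowI[of _ 0]) (auto simp: energy_nonneg)

lemma min_energy_le: "p \<in> feasible n \<Longrightarrow> min_energy n \<le> energy p"
  unfolding min_energy_eq_Inf by (intro cInf_lower bdd_below_energy) auto

lemma min_energy_nonneg: "0 \<le> min_energy n"
  unfolding min_energy_eq_Inf by (intro cInf_greatest) (use one_feasible energy_nonneg in auto)

text \<open>
  The spaces of admissible polynomials increase with the degree.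
\<close>

lemma decseq_min_energy: "decseq min_energy"
proof (rule decseq_SucI)
  fix n
  have "feasible n \<subseteq> feasible (Suc n)"
    using tensor_polys_mono[OF finite_D order_refl, of n "Suc n"] by (auto simp: feasible_def)
  then show "min_energy (Suc n) \<le> min_energy n"
    unfolding min_energy_eq_Inf using one_feasible by (intro cInf_superset_mono bdd_below_energy) auto
qed

definition value_limit :: real where "value_limit = Inf (range min_energy)"

lemma min_energy_tendsto: "min_energy \<longlonglongrightarrow> value_limit"
proof -
  have "bdd_below (range min_energy)" by (rule bdd_belowI[of _ 0]) (auto simp: min_energy_nonneg)
  then show ?thesis unfolding value_limit_def using decseq_min_energy by (rule LIMSEQ_decseq_INF)
qed

lemma value_limit_nonneg: "0 \<le> value_limit"
  using min_energy_tendsto min_energy_nonneg by (intro LIMSEQ_le_const) auto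

lemma value_limit_le: "value_limit \<le> min_energy n"
  using decseq_ge[OF decseq_min_energy min_energy_tendsto] .

lemma integrable_w_mult:
  assumes "q \<in> borel_measurable (leb D)" "\<And>x. x \<in> K \<Longrightarrow> \<bar>q x\<bar> \<le> B"
  shows "integrable (leb D) (\<lambda>x. w x * q x)"
proof (rule Bochner_Integration.integrable_bound)
  show "integrable (leb D) (\<lambda>x. B * w x)" using w_integrable by simp
  show "(\<lambda>x. w x * q x) \<in> borel_measurable (leb D)" using assms w_measurable by simp
  show "AE x in leb D. norm (w x * q x) \<le> norm (B * w x)"
    using AE_RA
  proof eventually_elim
    case (elim x)
    show ?case
    proof (cases "x \<in> K")
      case True
      then have "0 \<le> B" "\<bar>q x\<bar> \<le> B" using assms(2)[OF True] by auto
      then show ?thesis by (simp add: abs_mult mult.commute mult_right_mono)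
    qed (use elim w_zero in auto)
  qed
qed

lemma integrable_cube:
  fixes q :: "(nat \<Rightarrow> real) \<Rightarrow> real"
  assumes "q \<in> borel_measurable (leb D)" "\<And>x. x \<in> K \<Longrightarrow> \<bar>q x\<bar> \<le> B"
  shows "integrable (leb D) (\<lambda>x. indicator (B_inf D z \<epsilon>) x * q x)"
proof (rule Bochner_Integration.integrable_bound)
  show "integrable (leb D) (\<lambda>x. B * indicator (B_inf D z \<epsilon>) x)"
    using emeasure_B_inf[OF finite_D eps_pos, of z] by simp
  show "(\<lambda>x. indicator (B_inf D z \<epsilon>) x * q x) \<in> borel_measurable (leb D)" using assms by simp
  show "AE x in leb D. norm (indicator (B_inf D z \<epsilon>) x * q x) \<le> norm (B * indicator (B_inf D z \<epsilon>) x)"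
    using assms(2) cube_subset_K by (intro AE_I2) (force simp: indicator_def)
qed

lemma bounded_on_K:
  fixes q :: "(nat \<Rightarrow> real) \<Rightarrow> real"
  assumes "continuous_on K q"
  obtains B where "\<And>x. x \<in> K \<Longrightarrow> \<bar>q x\<bar> \<le> B"
proof -
  have "bounded (q ` K)" using assms compact_K by (intro compact_imp_bounded compact_continuous_image)
  then show ?thesis using that unfolding bounded_iff by auto
qed

text \<open>
  Both functionals are integrals against finite measures carried by \<open>K\<close>, so dominated convergence
  applies. The error bound \<open>1 / (i + 1)\<close> is at most 1, which provides the common bound \<open>B + 1\<close>.
\<close>

lemma uniform_limit_avg_energy:
  assumes p: "\<And>i::nat. p i \<in> borel_measurable (leb D)" and g: "g \<in> borel_measurable (leb D)" "continuous_on K g"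
    and close: "\<And>i x. x \<in> K \<Longrightarrow> \<bar>p i x - g x\<bar> < 1 / (real i + 1)"
  shows "(\<lambda>i. avg (p i)) \<longlonglongrightarrow> avg g" and "(\<lambda>i. energy (p i)) \<longlonglongrightarrow> energy g"
proof -
  obtain B where B: "\<And>x. x \<in> K \<Longrightarrow> \<bar>g x\<bar> \<le> B" using bounded_on_K[OF g(2)] by blast
  have pB: "\<bar>p i x\<bar> \<le> B + 1" if "x \<in> K" for i x
  proof -
    have "1 / (real i + 1) \<le> 1" by simp
    then show ?thesis using B[OF that] close[OF that, of i] by linarith
  qed
  have lim: "(\<lambda>i. p i x) \<longlonglongrightarrow> g x" if "x \<in> K" for x
  proof -
    have "(\<lambda>i. p i x - g x) \<longlonglongrightarrow> 0"
    proof (rule Lim_null_comparison)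
      show "\<forall>\<^sub>F i in sequentially. norm (p i x - g x) \<le> 1 / (real i + 1)"
        using close[OF that] by (intro always_eventually) (auto intro: less_imp_le)
      show "(\<lambda>i. 1 / (real i + 1)) \<longlonglongrightarrow> 0" using LIMSEQ_inverse_real_of_nat by (simp add: inverse_eq_divide add.commute)
    qed
    then show ?thesis by (simp add: LIM_zero_iff)
  qed
  have KI: "AE x in leb D. x \<notin> K \<longrightarrow> w x = 0" using AE_RA by eventually_elim (use w_zero in auto)
  show "(\<lambda>i. avg (p i)) \<longlonglongrightarrow> avg g"
    unfolding avg_def set_lebesgue_integral_def
  proof (rule integral_dominated_convergence)
    show "integrable (leb D) (\<lambda>x. indicator (B_inf D z \<epsilon>) x * ((B + 1) / \<epsilon> ^ card D))"
      using emeasure_B_inf[OF finite_D eps_pos, of z] by simp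
    show "AE x in leb D. (\<lambda>i. indicator (B_inf D z \<epsilon>) x *\<^sub>R (p i x / \<epsilon> ^ card D))
        \<longlonglongrightarrow> indicator (B_inf D z \<epsilon>) x *\<^sub>R (g x / \<epsilon> ^ card D)"
      using lim cube_subset_K eps_pos by (intro AE_I2) (auto simp: indicator_def intro!: tendsto_divide)
    show "AE x in leb D. norm (indicator (B_inf D z \<epsilon>) x *\<^sub>R (p i x / \<epsilon> ^ card D))
        \<le> indicator (B_inf D z \<epsilon>) x * ((B + 1) / \<epsilon> ^ card D)" for i
      using pB cube_subset_K eps_pos
      by (intro AE_I2) (auto simp: indicator_def divide_right_mono subset_iff)
  qed (use p g in measurable)
  show "(\<lambda>i. energy (p i)) \<longlonglongrightarrow> energy g"
    unfolding energy_def
  proof (rule integral_dominated_convergence)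
    show "integrable (leb D) (\<lambda>x. w x * (B + 1)\<^sup>2)" using w_integrable by simp
    show "AE x in leb D. (\<lambda>i. w x * (p i x)\<^sup>2) \<longlonglongrightarrow> w x * (g x)\<^sup>2"
      using KI
    proof eventually_elim
      case (elim x)
      then show ?case
        by (cases "x \<in> K") (auto intro!: tendsto_mult tendsto_power lim)
    qed
    show "AE x in leb D. norm (w x * (p i x)\<^sup>2) \<le> w x * (B + 1)\<^sup>2" for i
      using KI w_AE_nonneg
    proof eventually_elim
      case (elim x)
      have "(p i x)\<^sup>2 \<le> (B + 1)\<^sup>2" if "x \<in> K"
        using pB[OF that, of i] abs_le_square_iff[of "p i x" "B + 1"] by auto
      then show ?case using elim by (cases "x \<in> K") (auto simp: abs_mult intro!: mult_left_mono)
    qed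
  qed (use p g w_measurable in measurable)
qed

text \<open>
  Continuous functions are admissible competitors in the limit problem: polynomials that approximate
  \<open>g\<close> uniformly and are rescaled to mean 1 have energies converging to the right-hand side.
\<close>

lemma value_limit_le_quotient:
  assumes g: "g \<in> borel_measurable (leb D)" "continuous_on K g" and avg: "avg g \<noteq> 0"
  shows "value_limit \<le> energy g / (avg g)\<^sup>2"
proof -
  have "\<exists>p n. p \<in> tensor_polys D n \<and> (\<forall>x\<in>K. \<bar>p x - g x\<bar> < 1 / (real i + 1))" for i :: nat
  proof -
    have "0 < 1 / (real i + 1)" by simp
    from tensor_polys_dense[OF finite_D compact_K K_subset g(2) this] show ?thesis by metis
  qed
  then obtain p n where p: "\<And>i. p i \<in> tensor_polys D (n i)"
    and close: "\<And>i x. x \<in> K \<Longrightarrow> \<bar>p i x - g x\<bar> < 1 / (real i + 1)" by metis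
  have lim: "(\<lambda>i. avg (p i)) \<longlonglongrightarrow> avg g" "(\<lambda>i. energy (p i)) \<longlonglongrightarrow> energy g"
    using uniform_limit_avg_energy[OF tensor_polys_measurable[OF p] g close] by simp_all
  have "(\<lambda>i. energy (p i) / (avg (p i))\<^sup>2) \<longlonglongrightarrow> energy g / (avg g)\<^sup>2"
    using avg by (intro tendsto_divide tendsto_power lim) auto
  moreover have "\<forall>\<^sub>F i in sequentially. value_limit \<le> energy (p i) / (avg (p i))\<^sup>2"
    using tendsto_imp_eventually_ne[OF lim(1) avg]
  proof eventually_elim
    case (elim i)
    have "(\<lambda>x. inverse (avg (p i)) * p i x) \<in> feasible (n i)"
      unfolding feasible_def using tensor_polys_scale[OF p] elim by (simp add: avg_scale)
    from min_energy_le[OF this] value_limit_le[of "n i"] show ?case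
      
      unfolding energy_scale power_inverse divide_inverse mult.commute[of "energy (p i)"] by linarith
  qed
  ultimately show ?thesis by (intro tendsto_lowerbound) auto
qed

text \<open>
  The minimizer \<open>1 / w\<close> of the limit problem need not be bounded on the cube. The cutoff makes it
  continuous, hence a competitor.
\<close>

definition recip_cutoff :: "nat \<Rightarrow> (nat \<Rightarrow> real) \<Rightarrow> real" where
  "recip_cutoff j x = cutoff D z \<epsilon> j x / w x"

lemma recip_cutoff_measurable: "recip_cutoff j \<in> borel_measurable (leb D)"
  unfolding recip_cutoff_def[abs_def] using cutoff_measurable w_measurable by (rule borel_measurable_divide)

lemma recip_cutoff_continuous: "continuous_on K (recip_cutoff j)"
proof -
  have "continuous_on (open_cube D z \<epsilon>) (\<lambda>x. 1 / w x)"
    using w_pos by (intro continuous_intros w_continuous) force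
  from continuous_on_subset[OF continuous_on_cutoff_mult[OF finite_D this] K_subset]
  show ?thesis by (simp add: recip_cutoff_def[abs_def])
qed

lemma recip_cutoff_outside: "x \<in> RA D \<Longrightarrow> x \<notin> open_cube D z \<epsilon> \<Longrightarrow> recip_cutoff j x = 0"
  by (simp add: recip_cutoff_def cutoff_outside finite_D)

lemma recip_cutoff_nonneg: "x \<in> RA D \<Longrightarrow> 0 \<le> recip_cutoff j x"
  by (simp add: recip_cutoff_def cutoff_bounds w_nonneg)

lemma recip_cutoff_integrable: "integrable (leb D) (recip_cutoff j)"
proof -
  obtain B where B: "\<And>x. x \<in> K \<Longrightarrow> \<bar>recip_cutoff j x\<bar> \<le> B" using bounded_on_K[OF recip_cutoff_continuous] by blast
  have "integrable (leb D) (\<lambda>x. indicator (B_inf D z \<epsilon>) x * recip_cutoff j x)"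
    by (rule integrable_cube[OF recip_cutoff_measurable B])
  moreover have "indicator (B_inf D z \<epsilon>) x * recip_cutoff j x = recip_cutoff j x" if "x \<in> space (leb D)" for x
    using recip_cutoff_outside[of x j] that open_cube_subset[of D z \<epsilon>] by (auto simp: indicator_def space_leb)
  ultimately show ?thesis by (simp cong: Bochner_Integration.integrable_cong)
qed

lemma avg_recip_cutoff: "avg (recip_cutoff j) = (LINT x|leb D. recip_cutoff j x) / \<epsilon> ^ card D"
proof -
  have "avg (recip_cutoff j) = (LINT x|leb D. recip_cutoff j x / \<epsilon> ^ card D)"
    unfolding avg_def set_lebesgue_integral_def
  proof (rule Bochner_Integration.integral_cong[OF refl])
    fix x assume "x \<in> space (leb D)"
    then show "indicator (B_inf D z \<epsilon>) x *\<^sub>R (recip_cutoff j x / \<epsilon> ^ card D) = recip_cutoff j x / \<epsilon> ^ card D"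
      using recip_cutoff_outside[of x j] open_cube_subset[of D z \<epsilon>] by (auto simp: indicator_def space_leb)
  qed
  then show ?thesis by simp
qed

text \<open>
  With a cutoff \<open>\<phi>\<close> the energy density is \<open>w * (\<phi> / w)\<^sup>2 = \<phi>\<^sup>2 / w\<close>, and \<open>\<phi>\<^sup>2 \<le> \<phi>\<close>.
\<close>

lemma energy_recip_cutoff: "energy (recip_cutoff j) \<le> (LINT x|leb D. recip_cutoff j x)"
  unfolding energy_def
proof (rule integral_mono_AE)
  obtain B where "\<And>x. x \<in> K \<Longrightarrow> \<bar>(recip_cutoff j x)\<^sup>2\<bar> \<le> B"
    using bounded_on_K[OF continuous_on_power[OF recip_cutoff_continuous[of j], of 2]] by blast
  then show "integrable (leb D) (\<lambda>x. w x * (recip_cutoff j x)\<^sup>2)"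
    by (intro integrable_w_mult borel_measurable_power recip_cutoff_measurable)
  show "AE x in leb D. w x * (recip_cutoff j x)\<^sup>2 \<le> recip_cutoff j x"
    using AE_RA
  proof eventually_elim
    case (elim x)
    show ?case
    proof (cases "x \<in> open_cube D z \<epsilon>")
      case True
      have "w x * (recip_cutoff j x)\<^sup>2 = cutoff D z \<epsilon> j x * recip_cutoff j x"
        using w_pos[OF True] by (simp add: recip_cutoff_def power2_eq_square)
      also have "\<dots> \<le> 1 * recip_cutoff j x"
        using elim by (intro mult_right_mono cutoff_bounds recip_cutoff_nonneg)
      finally show ?thesis by simp
    qed (use elim recip_cutoff_outside in simp)
  qed
qed (rule recip_cutoff_integrable)

text \<open>
  For the competitor \<open>\<phi> / w\<close> with integral \<open>I\<close> the quotient of energy and squared mean is at most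
  \<open>I / (I / \<epsilon> ^ card D)\<^sup>2\<close>. The product form also covers \<open>I = 0\<close>.
\<close>

lemma value_limit_mult_integral_le: "value_limit * (LINT x|leb D. recip_cutoff j x) \<le> (\<epsilon> ^ card D)\<^sup>2"
proof -
  define I where "I = (LINT x|leb D. recip_cutoff j x)"
  have "0 \<le> I" unfolding I_def using AE_RA recip_cutoff_nonneg by (intro integral_nonneg_AE) (auto elim: AE_mp)
  show ?thesis
  proof (cases "I = 0")
    case False
    then have "value_limit \<le> energy (recip_cutoff j) / (I / \<epsilon> ^ card D)\<^sup>2"
      using value_limit_le_quotient[OF recip_cutoff_measurable recip_cutoff_continuous, of j] eps_pos by (simp add: avg_recip_cutoff I_def)
    also have "\<dots> \<le> I / (I / \<epsilon> ^ card D)\<^sup>2"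
      using energy_recip_cutoff[of j] by (intro divide_right_mono) (auto simp: I_def)
    also have "\<dots> = (\<epsilon> ^ card D)\<^sup>2 / I" using False by (simp add: power2_eq_square field_simps)
    finally show ?thesis using False \<open>0 \<le> I\<close> by (simp add: I_def field_simps)
  qed (simp add: I_def)
qed

definition recip :: "(nat \<Rightarrow> real) \<Rightarrow> real" where
  "recip x = indicator (open_cube D z \<epsilon>) x / w x"

lemma recip_measurable: "recip \<in> borel_measurable (leb D)"
  unfolding recip_def[abs_def] using w_measurable by measurable

lemma recip_nonneg: "0 \<le> recip x"
  using w_pos[of x] by (auto simp: recip_def indicator_def)

lemma recip_cutoff_tendsto: "x \<in> RA D \<Longrightarrow> (\<lambda>j. recip_cutoff j x) \<longlonglongrightarrow> recip x"
  using tendsto_mult_right[OF cutoff_tendsto_1, of x D z \<epsilon> "1 / w x"] recip_cutoff_outside[of x]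
  by (cases "x \<in> open_cube D z \<epsilon>") (simp add: recip_cutoff_def recip_def, simp add: recip_def)

text \<open>
  The integrals of the truncations are bounded by \<open>(\<epsilon> ^ card D)\<^sup>2 / value_limit\<close>, and Fatou's lemma
  passes this bound on to \<open>1 / w\<close>.
\<close>

lemma value_limit_pos_imp_integrable:
  assumes "0 < value_limit"
  shows "integrable (leb D) recip" and "value_limit * (LINT x|leb D. recip x) \<le> (\<epsilon> ^ card D)\<^sup>2"
proof -
  define C where "C = (\<epsilon> ^ card D)\<^sup>2 / value_limit"
  have "0 \<le> C" using assms by (simp add: C_def)
  have le: "(\<integral>\<^sup>+x. ennreal (recip_cutoff j x) \<partial>leb D) \<le> ennreal C" for j
  proof -
    have "AE x in leb D. 0 \<le> recip_cutoff j x" using AE_RA by eventually_elim (rule recip_cutoff_nonneg)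
    then have "(\<integral>\<^sup>+x. ennreal (recip_cutoff j x) \<partial>leb D) = ennreal (LINT x|leb D. recip_cutoff j x)"
      by (rule nn_integral_eq_integral[OF recip_cutoff_integrable])
    also have "\<dots> \<le> ennreal C"
      using value_limit_mult_integral_le[of j] assms by (intro ennreal_leI) (simp add: C_def field_simps)
    finally show ?thesis .
  qed
  have "(\<integral>\<^sup>+x. ennreal (recip x) \<partial>leb D) = (\<integral>\<^sup>+x. liminf (\<lambda>j. ennreal (recip_cutoff j x)) \<partial>leb D)"
  proof (rule nn_integral_cong)
    fix x assume "x \<in> space (leb D)"
    then have "(\<lambda>j. ennreal (recip_cutoff j x)) \<longlonglongrightarrow> ennreal (recip x)"
      by (intro tendsto_ennrealI recip_cutoff_tendsto) (simp add: space_leb)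
    then show "ennreal (recip x) = liminf (\<lambda>j. ennreal (recip_cutoff j x))"
      using lim_imp_Liminf sequentially_bot by metis
  qed
  also have "\<dots> \<le> liminf (\<lambda>j. \<integral>\<^sup>+x. ennreal (recip_cutoff j x) \<partial>leb D)"
    using recip_cutoff_measurable by (intro nn_integral_liminf) auto
  also have "\<dots> \<le> ennreal C" using le by (intro Liminf_le) auto
  finally have fin: "(\<integral>\<^sup>+x. ennreal (recip x) \<partial>leb D) \<le> ennreal C" .
  then have "(\<integral>\<^sup>+x. ennreal (recip x) \<partial>leb D) < \<infinity>"
    by (rule order.strict_trans1) simp
  then show int: "integrable (leb D) recip"
    using recip_measurable recip_nonneg by (intro integrableI_nonneg) auto
  have "ennreal (LINT x|leb D. recip x) \<le> ennreal C"
    using fin nn_integral_eq_integral[OF int] recip_nonneg by simp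
  then have "(LINT x|leb D. recip x) \<le> C" using \<open>0 \<le> C\<close> by simp
  then show "value_limit * (LINT x|leb D. recip x) \<le> (\<epsilon> ^ card D)\<^sup>2"
    using assms by (simp add: C_def field_simps)
qed

lemma emeasure_open_cube_pos: "emeasure (leb D) (open_cube D z \<epsilon>) \<noteq> 0"
  using emeasure_open_cube[OF finite_D eps_pos, of z] eps_pos by simp

lemma integral_recip_pos:
  assumes "integrable (leb D) recip"
  shows "0 < (LINT x|leb D. recip x)"
proof -
  have "(LINT x|leb D. recip x) \<noteq> 0"
  proof
    assume "(LINT x|leb D. recip x) = 0"
    then have "AE x in leb D. recip x = 0"
      using integral_nonneg_eq_0_iff_AE[OF assms] recip_nonneg by simp
    then have "AE x in leb D. x \<notin> open_cube D z \<epsilon>"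
    proof eventually_elim
      case (elim x)
      then show ?case using w_pos[of x] by (auto simp: recip_def)
    qed
    then show False
      using emeasure_open_cube_pos AE_iff_measurable[OF sets_open_cube, of "\<lambda>x. x \<notin> open_cube D z \<epsilon>"]
        open_cube_subset_RA[of D z \<epsilon>]
      by (auto simp: space_leb subset_iff)
  qed
  moreover have "0 \<le> (LINT x|leb D. recip x)" by (intro integral_nonneg_AE AE_I2 recip_nonneg)
  ultimately show ?thesis by simp
qed

text \<open>
  This is the Cauchy-Schwarz inequality for \<open>p * sqrt w\<close> and \<open>1 / sqrt w\<close> on the cube, obtained by
  integrating \<open>w * p\<^sup>2 \<ge> 2 * t * p - t\<^sup>2 / w\<close> with the optimal \<open>t = \<epsilon> ^ card D / I\<close>.
\<close>

lemma energy_lower_bound: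
  assumes int: "integrable (leb D) recip" and p: "p \<in> feasible n"
  shows "(\<epsilon> ^ card D)\<^sup>2 / (LINT x|leb D. recip x) \<le> energy p"
proof -
  define I where "I = (LINT x|leb D. recip x)"
  define t where "t = \<epsilon> ^ card D / I"
  have "0 < I" unfolding I_def by (rule integral_recip_pos[OF int])
  have pt: "p \<in> tensor_polys D n" and "avg p = 1" using p by (auto simp: feasible_def)
  have pm[measurable]: "p \<in> borel_measurable (leb D)" by (rule tensor_polys_measurable[OF pt])
  obtain B where B: "\<And>x. x \<in> K \<Longrightarrow> \<bar>p x\<bar> \<le> B"
    using bounded_on_K[OF tensor_polys_continuous[OF pt]] by blast
  obtain B2 where B2: "\<And>x. x \<in> K \<Longrightarrow> \<bar>(p x)\<^sup>2\<bar> \<le> B2"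
    using bounded_on_K[OF continuous_on_power[OF tensor_polys_continuous[OF pt]]] by blast
  have intp: "integrable (leb D) (\<lambda>x. indicator (B_inf D z \<epsilon>) x * p x)"
    by (rule integrable_cube[OF pm B])
  have "(LINT x|leb D. indicator (B_inf D z \<epsilon>) x * p x) = \<epsilon> ^ card D"
  proof -
    have "avg p = (LINT x|leb D. (indicator (B_inf D z \<epsilon>) x * p x) / \<epsilon> ^ card D)"
      by (simp add: avg_def set_lebesgue_integral_def)
    then show ?thesis using \<open>avg p = 1\<close> eps_pos by simp
  qed
  then have "t * \<epsilon> ^ card D = (LINT x|leb D. 2 * t * (indicator (B_inf D z \<epsilon>) x * p x) - t\<^sup>2 * recip x)"
    using int intp \<open>0 < I\<close> by (simp add: t_def power2_eq_square flip: I_def)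
  also have "\<dots> \<le> energy p"
    unfolding energy_def
  proof (rule integral_mono_AE)
    show "integrable (leb D) (\<lambda>x. 2 * t * (indicator (B_inf D z \<epsilon>) x * p x) - t\<^sup>2 * recip x)"
      using int intp by simp
    show "integrable (leb D) (\<lambda>x. w x * (p x)\<^sup>2)" by (rule integrable_w_mult[OF _ B2]) measurable
    show "AE x in leb D. 2 * t * (indicator (B_inf D z \<epsilon>) x * p x) - t\<^sup>2 * recip x \<le> w x * (p x)\<^sup>2"
      using AE_B_inf_iff_open_cube[OF finite_D eps_pos, of z] w_AE_nonneg
    proof eventually_elim
      case (elim x)
      show ?case
      proof (cases "x \<in> open_cube D z \<epsilon>")
        case True
        \<comment> \<open>The square of \<open>p * sqrt w - t / sqrt w\<close>.\<close>
        have "0 \<le> (w x * p x - t)\<^sup>2 / w x" using w_pos[OF True] by simp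
        also have "\<dots> = w x * (p x)\<^sup>2 - 2 * t * p x + t\<^sup>2 / w x"
          using w_pos[OF True] by (simp add: field_simps power2_eq_square)
        finally show ?thesis using True elim by (simp add: recip_def)
      qed (use elim in \<open>auto simp: recip_def\<close>)
    qed
  qed
  finally show ?thesis by (simp add: t_def I_def power2_eq_square)
qed

lemma integrable_imp_value_limit_ge:
  assumes int: "integrable (leb D) recip"
  shows "(\<epsilon> ^ card D)\<^sup>2 / (LINT x|leb D. recip x) \<le> value_limit"
proof (rule LIMSEQ_le_const[OF min_energy_tendsto], intro exI allI impI)
  fix n
  show "(\<epsilon> ^ card D)\<^sup>2 / (LINT x|leb D. recip x) \<le> min_energy n"
    unfolding min_energy_eq_Inf
    by (rule cInf_greatest) (use one_feasible energy_lower_bound[OF int] in auto)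
qed

text \<open>
  Otherwise \<open>q\<close> minus its mean would be positive on the cube, with integral 0.
\<close>

lemma exists_le_mean:
  assumes int: "integrable (leb D) (\<lambda>x. indicator (open_cube D z \<epsilon>) x * q x)"
  shows "\<exists>a\<in>open_cube D z \<epsilon>. q a \<le> (LINT x|leb D. indicator (open_cube D z \<epsilon>) x * q x) / \<epsilon> ^ card D"
proof (rule ccontr)
  define m where "m = (LINT x|leb D. indicator (open_cube D z \<epsilon>) x * q x) / \<epsilon> ^ card D"
  assume "\<not> ?thesis"
  then have gt: "m < q x" if "x \<in> open_cube D z \<epsilon>" for x using that by (auto simp: m_def not_le)
  have em: "emeasure (leb D) (open_cube D z \<epsilon>) = ennreal (\<epsilon> ^ card D)"
    by (rule emeasure_open_cube[OF finite_D eps_pos])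
  define r where "r x = indicator (open_cube D z \<epsilon>) x * q x - m * indicator (open_cube D z \<epsilon>) x" for x
  have intc: "integrable (leb D) (\<lambda>x. m * indicator (open_cube D z \<epsilon>) x)" using em by simp
  have "integrable (leb D) r" unfolding r_def using int intc by simp
  moreover have "0 \<le> r x" for x using gt[of x] by (auto simp: r_def indicator_def)
  moreover have "(LINT x|leb D. r x) = 0"
  proof -
    have "(LINT x|leb D. r x) = m * \<epsilon> ^ card D - m * measure (leb D) (open_cube D z \<epsilon>)"
      unfolding r_def using int intc eps_pos em by (simp add: m_def)
    then show ?thesis using em eps_pos by (simp add: measure_def)
  qed
  ultimately have "AE x in leb D. r x = 0" by (simp add: integral_nonneg_eq_0_iff_AE)
  then have "AE x in leb D. x \<notin> open_cube D z \<epsilon>"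
  proof eventually_elim
    case (elim x)
    then show ?case using gt[of x] by (auto simp: r_def)
  qed
  then show False
    using emeasure_open_cube_pos AE_iff_measurable[OF sets_open_cube, of "\<lambda>x. x \<notin> open_cube D z \<epsilon>"]
      open_cube_subset_RA[of D z \<epsilon>]
    by (auto simp: space_leb subset_iff)
qed

text \<open>
  The upper and the lower bound meet at \<open>(\<epsilon> ^ card D)\<^sup>2 / I\<close>, and the continuous function \<open>1 / w\<close> takes
  its mean value \<open>I / \<epsilon> ^ card D\<close> on the open cube.
\<close>

lemma value_limit_pos_imp_mean_value:
  assumes "0 < value_limit"
  shows "\<exists>\<zeta>\<in>open_cube D z \<epsilon>. value_limit = \<epsilon> ^ card D * w \<zeta>"
proof -
  note int = value_limit_pos_imp_integrable(1)[OF assms]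
  define I where "I = (LINT x|leb D. recip x)"
  have "0 < I" unfolding I_def by (rule integral_recip_pos[OF int])
  have value_limit: "value_limit = (\<epsilon> ^ card D)\<^sup>2 / I"
    using value_limit_pos_imp_integrable(2)[OF assms] integrable_imp_value_limit_ge[OF int] \<open>0 < I\<close>
    by (simp add: I_def field_simps)
  obtain a where a: "a \<in> open_cube D z \<epsilon>" "1 / w a \<le> I / \<epsilon> ^ card D"
    using exists_le_mean[of "\<lambda>x. 1 / w x"] int by (auto simp: I_def recip_def[abs_def])
  obtain b where b: "b \<in> open_cube D z \<epsilon>" "I / \<epsilon> ^ card D \<le> 1 / w b"
    using exists_le_mean[of "\<lambda>x. - (1 / w x)"] int by (auto simp: I_def recip_def[abs_def])
  have "continuous_on (open_cube D z \<epsilon>) (\<lambda>x. 1 / w x)"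
    using w_pos by (intro continuous_intros w_continuous) force
  from open_cube_IVT[OF this a b] obtain \<zeta>
    where \<zeta>: "\<zeta> \<in> open_cube D z \<epsilon>" "1 / w \<zeta> = I / \<epsilon> ^ card D" by blast
  have "w \<zeta> = \<epsilon> ^ card D / I" using \<zeta>(2) by (metis divide_divide_eq_right div_by_1 mult_1)
  then show ?thesis using \<zeta> by (intro bexI[of _ \<zeta>]) (auto simp: value_limit power2_eq_square)
qed

text \<open>
  If \<open>w\<close> were bounded below by \<open>m > 0\<close> on the open cube, then \<open>1 / w\<close> would be integrable and the lower
  bound for the energies positive.
\<close>

lemma value_limit_zero_imp_small_values:
  assumes "value_limit = 0" "0 < m"
  shows "\<exists>x\<in>open_cube D z \<epsilon>. w x < m"
proof (rule ccontr)
  assume "\<not> ?thesis"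
  then have ge: "m \<le> w x" if "x \<in> open_cube D z \<epsilon>" for x using that by (auto simp: not_less)
  have "integrable (leb D) recip"
  proof (rule Bochner_Integration.integrable_bound)
    show "integrable (leb D) (\<lambda>x. (1 / m) * indicator (open_cube D z \<epsilon>) x)"
      using emeasure_open_cube[OF finite_D eps_pos, of z] by simp
    show "AE x in leb D. norm (recip x) \<le> norm ((1 / m) * indicator (open_cube D z \<epsilon>) x)"
      using ge assms(2) by (intro AE_I2) (auto simp: recip_def indicator_def intro!: frac_le order.trans[OF ge abs_ge_self])
  qed (rule recip_measurable)
  from integrable_imp_value_limit_ge[OF this] integral_recip_pos[OF this] assms(1) eps_pos show False
    by (simp add: divide_le_0_iff)
qed

end

section \<open>The minima of the marginals\<close>

locale compactly_supported_density =
  fixes d :: nat and \<mu> :: "(nat \<Rightarrow> real) measure" and f :: "(nat \<Rightarrow> real) \<Rightarrow> real"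
    and \<Omega> :: "(nat \<Rightarrow> real) set" and \<epsilon> :: real and z :: "nat \<Rightarrow> real"
  assumes prob: "prob_space \<mu>"
    and f_measurable: "f \<in> borel_measurable (leb {1..d})"
    and f_nonneg: "\<And>x. x \<in> RA {1..d} \<Longrightarrow> 0 \<le> f x"
    and f_density: "\<mu> = density (leb {1..d}) (\<lambda>x. ennreal (f x))"
    and support_compact: "compactin (RA_top {1..d}) \<Omega>"
    and continuous: "\<And>A. A \<noteq> {} \<Longrightarrow> A \<subseteq> {1..d} \<Longrightarrow>
        continuous_map (subtopology (RA_top A) (RA_top A interior_of (proj A \<Omega>)))
          euclideanreal (marginal_density d f A)"
    and positive: "\<And>A x. A \<noteq> {} \<Longrightarrow> A \<subseteq> {1..d} \<Longrightarrow>
        x \<in> RA_top A interior_of (proj A \<Omega>) \<Longrightarrow> 0 < marginal_density d f A x"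
    and zero_outside: "\<And>A x. A \<noteq> {} \<Longrightarrow> A \<subseteq> {1..d} \<Longrightarrow>
        x \<in> RA A - proj A \<Omega> \<Longrightarrow> marginal_density d f A x = 0"
    and eps_pos: "0 < \<epsilon>"
    and cube_subset: "B_inf {1..d} z \<epsilon> \<subseteq> \<Omega>"
begin

lemma sets_\<mu>: "sets \<mu> = sets (leb {1..d})"
  by (simp add: f_density)

lemma prob_space_marginal: "D \<subseteq> {1..d} \<Longrightarrow> prob_space (marginal D \<mu>)"
  unfolding marginal_def
  by (rule prob_space.prob_space_distr[OF prob])
    (simp add: measurable_cong_sets[OF sets_\<mu> refl] leb_def measurable_restrict_subset)

lemma marginal_eq:
  assumes "D \<subseteq> {1..d}" "D \<noteq> {}"
  shows "marginal D \<mu> = density (leb D) (\<lambda>x. ennreal (marginal_density d f D x))"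
  by (rule marginal_eq_density[OF prob f_density f_measurable _ assms]) (rule f_nonneg)

lemma cube_subset_proj:
  assumes "D \<subseteq> {1..d}"
  shows "B_inf D z \<epsilon> \<subseteq> proj D \<Omega>"
proof
  fix x assume x: "x \<in> B_inf D z \<epsilon>"
  \<comment> \<open>A point of the cube in \<open>\<real>\<^sup>D\<close> is completed by the remaining coordinates of the centre.\<close>
  define y where "y = (\<lambda>k\<in>{1..d}. if k \<in> D then x k else z k)"
  have "y \<in> B_inf {1..d} z \<epsilon>"
    using x assms eps_pos by (auto simp: B_inf_def RA_def y_def)
  moreover have "restrict y D k = x k" for k
    using x subsetD[OF assms, of k]
    by (cases "k \<in> D") (auto simp: B_inf_def RA_def y_def PiE_iff extensional_def)
  then have "restrict y D = x" by (rule ext)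
  ultimately show "x \<in> proj D \<Omega>" using cube_subset unfolding proj_def by blast
qed

lemma compact_proj:
  assumes "D \<subseteq> {1..d}"
  shows "compact (proj D \<Omega>)" and "proj D \<Omega> \<subseteq> RA D"
proof -
  have "compact \<Omega>" using support_compact by (simp add: RA_top_eq compactin_subtopology)
  moreover have "continuous_on \<Omega> (\<lambda>x. restrict x D)"
  proof (rule continuous_on_coordinatewise_then_product)
    fix k show "continuous_on \<Omega> (\<lambda>x. restrict x D k)"
      by (cases "k \<in> D") (auto intro: continuous_on_subset[OF continuous_on_product_coordinates])
  qed
  ultimately show "compact (proj D \<Omega>)" unfolding proj_def by (rule compact_continuous_image[rotated])
  show "proj D \<Omega> \<subseteq> RA D" by (auto simp: proj_def RA_def)
qed

lemma open_cube_subset_interior: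
  assumes "D \<subseteq> {1..d}"
  shows "open_cube D z \<epsilon> \<subseteq> RA_top D interior_of (proj D \<Omega>)"
proof (rule interior_of_maximal)
  show "open_cube D z \<epsilon> \<subseteq> proj D \<Omega>" using cube_subset_proj[OF assms] open_cube_subset by blast
  show "openin (RA_top D) (open_cube D z \<epsilon>)"
    unfolding RA_top_eq by (rule openin_open_cube) (use assms in \<open>auto intro: finite_subset\<close>)
qed

lemma cube_in_support_marginal:
  assumes D: "D \<subseteq> {1..d}" "D \<noteq> {}"
  shows "cube_in_support D z \<epsilon> (marginal_density d f D) (proj D \<Omega>)"
proof
  show fin: "finite D" using D(1) by (auto intro: finite_subset)
  show wm: "marginal_density d f D \<in> borel_measurable (leb D)"
    by (rule marginal_density_measurable[OF D f_measurable])
  show nonneg: "0 \<le> marginal_density d f D x" if "x \<in> RA D" for x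
    by (rule marginal_density_nonneg[OF D(1) that f_nonneg])
  show "integrable (leb D) (marginal_density d f D)"
  proof (rule integrableI_nonneg[OF wm])
    show "AE x in leb D. 0 \<le> marginal_density d f D x"
      by (intro AE_I2 nonneg) (simp add: space_leb)
    have "emeasure (marginal D \<mu>) (space (marginal D \<mu>)) = 1"
      by (rule prob_space.emeasure_space_1[OF prob_space_marginal[OF D(1)]])
    then have "(\<integral>\<^sup>+x. ennreal (marginal_density d f D x) \<partial>leb D) = 1"
      unfolding marginal_eq[OF D]
      using wm by (simp add: emeasure_density cong: nn_integral_cong)
    then show "(\<integral>\<^sup>+x. ennreal (marginal_density d f D x) \<partial>leb D) < \<infinity>" by simp
  qed
  show "compact (proj D \<Omega>)" "proj D \<Omega> \<subseteq> RA D" by (fact compact_proj[OF D(1)])+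
  show "marginal_density d f D x = 0" if "x \<in> RA D" "x \<notin> proj D \<Omega>" for x
    using zero_outside[OF D(2,1)] that by simp
  show "B_inf D z \<epsilon> \<subseteq> proj D \<Omega>" by (rule cube_subset_proj[OF D(1)])
  have "continuous_on (RA D \<inter> RA_top D interior_of (proj D \<Omega>)) (marginal_density d f D)"
    using continuous[OF D(2,1)] by (simp add: RA_top_eq subtopology_subtopology)
  then show "continuous_on (open_cube D z \<epsilon>) (marginal_density d f D)"
    by (rule continuous_on_subset) (use open_cube_subset_interior[OF D(1)] open_cube_subset_RA in blast)
  show "0 < marginal_density d f D x" if "x \<in> open_cube D z \<epsilon>" for x
    using positive[OF D(2,1)] open_cube_subset_interior[OF D(1)] that by blast
qed (rule eps_pos)

text \<open>
  The reciprocal is the quantity that converges: by the convention for \<open>christoffel\<close> it is the value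
  of the minimization problem, and 1 for the empty set.
\<close>

definition marginal_min :: "nat set \<Rightarrow> nat \<Rightarrow> real" where
  "marginal_min D n = inverse (christoffel D n (marginal D \<mu>) (restrict z D) \<epsilon>)"

lemma marginal_min_empty: "marginal_min {} n = 1"
  by (simp add: marginal_min_def christoffel_def)

lemma marginal_min_eq: "D \<noteq> {} \<Longrightarrow> marginal_min D n = christoffel_min D n (marginal D \<mu>) z \<epsilon>"
  by (simp add: marginal_min_def christoffel_def christoffel_min_def B_inf_restrict)

text \<open>
  The two kinds of limit are kept apart: a positive limit is \<open>\<epsilon> ^ card D\<close> times a value of the density,
  while for the limit 0 such a value, namely 0, is obtained from the assumption that the density
  attains its minimum on the closed cube. The last conjunct provides the points used for separators with limit 0.
\<close>

lemma marginal_min_limit: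
  assumes D: "D \<subseteq> {1..d}"
  shows "\<exists>L. marginal_min D \<longlonglongrightarrow> L \<and> 0 \<le> L
    \<and> (0 < L \<longrightarrow> (\<exists>\<zeta>\<in>B_inf D z \<epsilon>. L = \<epsilon> ^ card D * marginal_density d f D \<zeta>))
    \<and> (L = 0 \<and> attains_min_on (marginal_density d f D) (B_inf D z \<epsilon>)
        \<longrightarrow> (\<exists>\<zeta>\<in>B_inf D z \<epsilon>. marginal_density d f D \<zeta> = 0))
    \<and> (\<exists>\<zeta>\<in>B_inf D z \<epsilon>. marginal_density d f D \<zeta> \<noteq> 0)"
proof (cases "D = {}")
  case True
  have "restrict z {} \<in> B_inf {} z \<epsilon>" by (simp add: B_inf_def RA_def restrict_def)
  moreover have "marginal_min D = (\<lambda>_. 1)" by (simp add: fun_eq_iff marginal_min_empty True)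
  ultimately show ?thesis by (intro exI[of _ 1]) (auto simp: True marginal_density_def)
next
  case False
  interpret cube_in_support D z \<epsilon> "marginal_density d f D" "proj D \<Omega>"
    by (rule cube_in_support_marginal[OF D False])
  have "marginal_min D = min_energy"
    by (simp add: fun_eq_iff marginal_min_eq[OF False] min_energy_def marginal_eq[OF D False])
  then have lim: "marginal_min D \<longlonglongrightarrow> value_limit" using min_energy_tendsto by simp
  have zero: "\<exists>\<zeta>\<in>B_inf D z \<epsilon>. marginal_density d f D \<zeta> = 0"
    if L0: "value_limit = 0" and min: "attains_min_on (marginal_density d f D) (B_inf D z \<epsilon>)"
  proof -
    obtain \<xi> where \<xi>: "\<xi> \<in> B_inf D z \<epsilon>" "\<And>y. y \<in> B_inf D z \<epsilon> \<Longrightarrow> marginal_density d f D \<xi> \<le> marginal_density d f D y"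
      using min by (auto simp: attains_min_on_def)
    have "\<not> 0 < marginal_density d f D \<xi>"
      using value_limit_zero_imp_small_values[OF L0] \<xi>(2) open_cube_subset by (meson not_less subsetD)
    moreover have "0 \<le> marginal_density d f D \<xi>"
      using \<xi>(1) by (intro w_nonneg) (simp add: B_inf_def)
    ultimately show ?thesis using \<xi>(1) by (intro bexI[of _ \<xi>]) auto
  qed
  have "marginal_density d f D (restrict z D) \<noteq> 0"
    using w_pos[OF restrict_mem_open_cube[OF eps_pos]] by simp
  then have nz: "\<exists>\<zeta>\<in>B_inf D z \<epsilon>. marginal_density d f D \<zeta> \<noteq> 0"
    using restrict_mem_open_cube[OF eps_pos] open_cube_subset by blast
  have pos: "\<exists>\<zeta>\<in>B_inf D z \<epsilon>. value_limit = \<epsilon> ^ card D * marginal_density d f D \<zeta>" if "0 < value_limit"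
    using value_limit_pos_imp_mean_value[OF that] open_cube_subset by blast
  show ?thesis using lim value_limit_nonneg zero nz pos by (intro exI[of _ value_limit]) blast
qed

lemma marginal_min_nonneg: "D \<subseteq> {1..d} \<Longrightarrow> 0 \<le> marginal_min D n"
proof (cases "D = {}")
  case False
  assume D: "D \<subseteq> {1..d}"
  interpret cube_in_support D z \<epsilon> "marginal_density d f D" "proj D \<Omega>"
    by (rule cube_in_support_marginal[OF D False])
  have "marginal_min D n = min_energy n"
    by (simp add: marginal_min_eq[OF False] min_energy_def marginal_eq[OF D False])
  then show ?thesis by (simp add: min_energy_nonneg)
qed (simp add: marginal_min_empty)

text \<open>
  A polynomial in the variables of \<open>S\<close> is also one in the variables of \<open>A\<close>, with the same energy and
  the same mean. So the infimum for \<open>A\<close> is taken over a larger set. For \<open>S = {}\<close> the constant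
  polynomial 1, of energy 1, plays this part.
\<close>

lemma marginal_min_antimono:
  assumes "S \<subseteq> A" and A: "A \<subseteq> {1..d}"
  shows "marginal_min A n \<le> marginal_min S n"
proof (cases "A = {}")
  case False
  have finA: "finite A" using A by (auto intro: finite_subset)
  define X where "X D = {(LINT x|marginal D \<mu>. (p x)\<^sup>2) | p.
      p \<in> tensor_polys D n \<and> (LINT y:B_inf D z \<epsilon>|leb D. p y / \<epsilon> ^ card D) = 1}" for D
  have bdd: "bdd_below (X A)" by (rule bdd_belowI[of _ 0]) (auto simp: X_def)
  have one: "1 \<in> X D" if D: "D \<subseteq> {1..d}" for D
  proof -
    have fin: "finite D" using D by (auto intro: finite_subset)
    have "(LINT x|marginal D \<mu>. ((\<lambda>_. 1 :: real) x)\<^sup>2) = 1"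
      using prob_space.prob_space[OF prob_space_marginal[OF D]] by simp
    then show ?thesis unfolding X_def mem_Collect_eq
      using cube_average_const[OF fin eps_pos] tensor_polys_const[OF fin]
      by (intro exI[of _ "\<lambda>_. 1"]) simp
  qed
  show ?thesis
  proof (cases "S = {}")
    case True
    have "Inf (X A) \<le> 1" by (intro cInf_lower bdd one A)
    then show ?thesis by (simp add: True marginal_min_empty marginal_min_eq[OF False] christoffel_min_def X_def)
  next
    case S: False
    have SD: "S \<subseteq> {1..d}" using assms by blast
    have "X S \<subseteq> X A"
    proof
      fix v assume "v \<in> X S"
      then obtain p where p: "v = (LINT x|marginal S \<mu>. (p x)\<^sup>2)" "p \<in> tensor_polys S n"
        "(LINT y:B_inf S z \<epsilon>|leb S. p y / \<epsilon> ^ card S) = 1" by (auto simp: X_def)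
      have pA: "p \<in> tensor_polys A n" using p(2) tensor_polys_mono[OF finA assms(1)] by blast
      have "(LINT x|marginal A \<mu>. (p x)\<^sup>2) = (LINT x|\<mu>. (p x)\<^sup>2)"
        using tensor_polys_measurable[OF pA] tensor_polys_restrict[OF p(2) assms(1)]
        by (subst integral_marginal[OF A sets_\<mu>]) auto
      also have "\<dots> = v"
        unfolding p(1) using tensor_polys_measurable[OF p(2)] tensor_polys_restrict[OF p(2) order_refl]
        by (subst integral_marginal[OF SD sets_\<mu>]) auto
      finally have "v = (LINT x|marginal A \<mu>. (p x)\<^sup>2)" by simp
      moreover have "(LINT y:B_inf A z \<epsilon>|leb A. p y / \<epsilon> ^ card A) = 1"
        using cube_average_tensor_poly[OF finA assms(1) eps_pos p(2)] p(3) by (rule trans)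
      ultimately show "v \<in> X A" unfolding X_def using pA by blast
    qed
    then have "Inf (X A) \<le> Inf (X S)" using one[OF SD] by (intro cInf_superset_mono bdd) auto
    then show ?thesis by (simp add: marginal_min_eq[OF False] marginal_min_eq[OF S] christoffel_min_def X_def)
  qed
qed (use assms in auto)

end

section \<open>The limit of the rational Christoffel function\<close>

theorem theorem4p10:
  fixes d :: nat
    and \<mu> :: "(nat \<Rightarrow> real) measure"
    and f :: "(nat \<Rightarrow> real) \<Rightarrow> real"
    and \<Omega> :: "(nat \<Rightarrow> real) set"
    and G :: "nat ugraph"
    and J :: "nat set ugraph"
    and \<epsilon> :: real
    and z :: "nat \<Rightarrow> real"
  assumes prob: "prob_space \<mu>"
    and f_measurable: "f \<in> borel_measurable (leb {1..d})"
    and f_nonneg: "\<And>x. x \<in> RA {1..d} \<Longrightarrow> 0 \<le> f x"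
    and f_density: "\<mu> = density (leb {1..d}) (\<lambda>x. ennreal (f x))"
    and support: "\<Omega> = supp {1..d} \<mu>"
    and support_compact: "compactin (RA_top {1..d}) \<Omega>"
    and regular: "\<And>A. A \<noteq> {} \<Longrightarrow> A \<subseteq> {1..d} \<Longrightarrow>
        proj A \<Omega> = RA_top A closure_of (RA_top A interior_of (proj A \<Omega>))"
    and continuous: "\<And>A. A \<noteq> {} \<Longrightarrow> A \<subseteq> {1..d} \<Longrightarrow>
        continuous_map (subtopology (RA_top A) (RA_top A interior_of (proj A \<Omega>)))
          euclideanreal (marginal_density d f A)"
    and positive: "\<And>A x. A \<noteq> {} \<Longrightarrow> A \<subseteq> {1..d} \<Longrightarrow>
        x \<in> RA_top A interior_of (proj A \<Omega>) \<Longrightarrow> 0 < marginal_density d f A x"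
    and zero_outside: "\<And>A x. A \<noteq> {} \<Longrightarrow> A \<subseteq> {1..d} \<Longrightarrow>
        x \<in> RA A - proj A \<Omega> \<Longrightarrow> marginal_density d f A x = 0"
    and graphical: "graphical_model d f G"
    and junction: "junction_tree G J"
    and eps_pos: "0 < \<epsilon>"
    and z_in: "z \<in> RA {1..d}"
    and cube_subset: "B_inf {1..d} z \<epsilon> \<subseteq> \<Omega>"
    and boundary_values: "\<And>C. C \<in> verts J \<Longrightarrow>
        attains_min_on (marginal_density d f C) (B_inf C (restrict z C) \<epsilon>)"
  shows "\<exists>\<zeta> :: nat set \<Rightarrow> nat \<Rightarrow> real.
      (\<forall>D \<in> verts J \<union> {A \<inter> B | A B. {A, B} \<in> edges J}. \<zeta> D \<in> B_inf D (restrict z D) \<epsilon>)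
      \<and> (\<forall>e \<in> edges J. marginal_density d f (\<Inter>e) (\<zeta> (\<Inter>e)) \<noteq> 0)
      \<and> (\<lambda>n. inverse (\<epsilon> ^ d) * inverse (rational_christoffel n \<mu> G J z \<epsilon>))
        \<longlonglongrightarrow> (\<Prod>C\<in>verts J. marginal_density d f C (\<zeta> C))
           / (\<Prod>e\<in>edges J. marginal_density d f (\<Inter>e) (\<zeta> (\<Inter>e)))"
proof -
  interpret compactly_supported_density d \<mu> f \<Omega> \<epsilon> z
    by (intro compactly_supported_density.intro prob f_measurable f_nonneg f_density support_compact
        continuous positive zero_outside eps_pos cube_subset)
  let ?V = "verts J" and ?E = "edges J" and ?w = "marginal_density d f"
  have simpleJ: "simple_graph J" and tree: "is_tree J" using junction by (auto simp: junction_tree_def is_tree_def)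
  have finV: "finite ?V" and finE: "finite ?E" using simpleJ finite_edges[OF simpleJ] by (auto simp: simple_graph_def)
  have vG: "verts G = {1..d}" using graphical by (simp add: graphical_model_def)
  have subV: "C \<subseteq> {1..d}" if "C \<in> ?V" for C
    using junction_tree_vertex_subset[OF junction that] by (simp add: vG)
  have edge: "\<exists>A\<in>e. A \<in> ?V" "e \<subseteq> ?V" if "e \<in> ?E" for e
  proof -
    show "e \<subseteq> ?V" using simpleJ that by (simp add: simple_graph_def)
    moreover have "e \<noteq> {}" using simpleJ that by (force simp: simple_graph_def)
    ultimately show "\<exists>A\<in>e. A \<in> ?V" by blast
  qed
  have subE: "\<Inter>e \<subseteq> {1..d}" if "e \<in> ?E" for e using edge[OF that] subV by blast
  obtain Lim where Lim: "\<And>D. D \<subseteq> {1..d} \<Longrightarrow> marginal_min D \<longlonglongrightarrow> Lim D \<and> 0 \<le> Lim D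
    \<and> (0 < Lim D \<longrightarrow> (\<exists>\<zeta>\<in>B_inf D z \<epsilon>. Lim D = \<epsilon> ^ card D * ?w D \<zeta>))
    \<and> (Lim D = 0 \<and> attains_min_on (?w D) (B_inf D z \<epsilon>) \<longrightarrow> (\<exists>\<zeta>\<in>B_inf D z \<epsilon>. ?w D \<zeta> = 0))
    \<and> (\<exists>\<zeta>\<in>B_inf D z \<epsilon>. ?w D \<zeta> \<noteq> 0)"
    using marginal_min_limit by metis
  have inv: "inverse (rational_christoffel n \<mu> G J z \<epsilon>) = (\<Prod>C\<in>?V. marginal_min C n) / (\<Prod>e\<in>?E. marginal_min (\<Inter>e) n)" for n
    by (simp add: rational_christoffel_def marginal_min_def prod_inversef[symmetric] comp_def divide_inverse)
  have clique_value: "\<exists>\<zeta>\<in>B_inf C z \<epsilon>. Lim C = \<epsilon> ^ card C * ?w C \<zeta>" if C: "C \<in> ?V" for C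
  proof (cases "0 < Lim C")
    case False
    then have L0: "Lim C = 0" using Lim[OF subV[OF C]] by auto
    then obtain \<zeta> where "\<zeta> \<in> B_inf C z \<epsilon>" "?w C \<zeta> = 0"
      using Lim[OF subV[OF C]] boundary_values[OF C] by (auto simp: B_inf_restrict)
    then show ?thesis using L0 by auto
  qed (use Lim[OF subV[OF C]] in auto)
  have separators: "{A \<inter> B | A B. {A, B} \<in> ?E} \<subseteq> Inter ` ?E"
  proof
    fix S assume "S \<in> {A \<inter> B | A B. {A, B} \<in> ?E}"
    then obtain A B where "{A, B} \<in> ?E" "S = \<Inter>{A, B}" by auto
    then show "S \<in> Inter ` ?E" by (rule rev_image_eqI)
  qed
  have in_cubes: "\<forall>D\<in>?V \<union> {A \<inter> B | A B. {A, B} \<in> ?E}. \<zeta> D \<in> B_inf D (restrict z D) \<epsilon>"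
    if \<zeta>: "\<And>D. D \<in> ?V \<union> Inter ` ?E \<Longrightarrow> \<zeta> D \<in> B_inf D z \<epsilon>" for \<zeta>
    unfolding B_inf_restrict using separators \<zeta> by blast
  show ?thesis
  proof (cases "\<forall>e\<in>?E. 0 < Lim (\<Inter>e)")
    \<comment> \<open>No separator degenerates: the quotient of the limits is the limit of the quotients.\<close>
    case sep_pos: True
    have "\<exists>\<zeta>. \<zeta> \<in> B_inf D z \<epsilon> \<and> Lim D = \<epsilon> ^ card D * ?w D \<zeta>" if D: "D \<in> ?V \<union> Inter ` ?E" for D
    proof (cases "D \<in> ?V")
      case False
      then obtain e where "e \<in> ?E" "D = \<Inter>e" using D by auto
      then show ?thesis using Lim[OF subE[of e]] sep_pos by auto
    qed (use clique_value in blast)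
    then obtain \<zeta> where \<zeta>: "\<And>D. D \<in> ?V \<union> Inter ` ?E \<Longrightarrow> \<zeta> D \<in> B_inf D z \<epsilon> \<and> Lim D = \<epsilon> ^ card D * ?w D (\<zeta> D)"
      by metis
    have "(\<lambda>n. inverse (\<epsilon> ^ d) * ((\<Prod>C\<in>?V. marginal_min C n) / (\<Prod>e\<in>?E. marginal_min (\<Inter>e) n)))
        \<longlonglongrightarrow> inverse (\<epsilon> ^ d) * ((\<Prod>C\<in>?V. Lim C) / (\<Prod>e\<in>?E. Lim (\<Inter>e)))"
      using Lim subV subE sep_pos finE
      by (intro tendsto_intros) (auto simp: less_le)
    also have "inverse (\<epsilon> ^ d) * ((\<Prod>C\<in>?V. Lim C) / (\<Prod>e\<in>?E. Lim (\<Inter>e)))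
        = (\<Prod>C\<in>?V. ?w C (\<zeta> C)) / (\<Prod>e\<in>?E. ?w (\<Inter>e) (\<zeta> (\<Inter>e)))"
    proof -
      have "(\<Prod>C\<in>?V. Lim C) = (\<Prod>C\<in>?V. \<epsilon> ^ card C * ?w C (\<zeta> C))"
        using \<zeta> by (intro prod.cong) auto
      also have "\<dots> = \<epsilon> ^ (d + (\<Sum>e\<in>?E. card (\<Inter>e))) * (\<Prod>C\<in>?V. ?w C (\<zeta> C))"
        using junction_tree_sum_card[OF junction] by (simp add: prod.distrib vG power_sum[symmetric])
      finally have 1: "(\<Prod>C\<in>?V. Lim C) = \<epsilon> ^ d * \<epsilon> ^ (\<Sum>e\<in>?E. card (\<Inter>e)) * (\<Prod>C\<in>?V. ?w C (\<zeta> C))"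
        by (simp add: power_add)
      have "(\<Prod>e\<in>?E. Lim (\<Inter>e)) = (\<Prod>e\<in>?E. \<epsilon> ^ card (\<Inter>e) * ?w (\<Inter>e) (\<zeta> (\<Inter>e)))"
        using \<zeta> by (intro prod.cong) auto
      also have "\<dots> = \<epsilon> ^ (\<Sum>e\<in>?E. card (\<Inter>e)) * (\<Prod>e\<in>?E. ?w (\<Inter>e) (\<zeta> (\<Inter>e)))"
        by (simp add: prod.distrib power_sum[symmetric])
      finally show ?thesis using eps_pos unfolding 1 by simp
    qed
    finally have lim: "(\<lambda>n. inverse (\<epsilon> ^ d) * inverse (rational_christoffel n \<mu> G J z \<epsilon>))
        \<longlonglongrightarrow> (\<Prod>C\<in>?V. ?w C (\<zeta> C)) / (\<Prod>e\<in>?E. ?w (\<Inter>e) (\<zeta> (\<Inter>e)))"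
      by (simp only: inv)
    have "?w (\<Inter>e) (\<zeta> (\<Inter>e)) \<noteq> 0" if "e \<in> ?E" for e
      using \<zeta>[of "\<Inter>e"] sep_pos that by force
    moreover have "\<forall>D\<in>?V \<union> {A \<inter> B | A B. {A, B} \<in> ?E}. \<zeta> D \<in> B_inf D (restrict z D) \<epsilon>"
      using \<zeta> by (intro in_cubes) blast
    ultimately show ?thesis using lim by blast
  next
    case False
    then obtain e0 where e0: "e0 \<in> ?E" "Lim (\<Inter>e0) = 0" by (metis Lim subE less_le)
    \<comment> \<open>The clique \<open>r\<close> contains the degenerate separator, so its minimum tends to 0 as well.\<close>
    obtain r where r: "r \<in> e0" "r \<in> ?V" using edge[OF e0(1)] by blast
    obtain b where b: "bij_betw b (?V - {r}) ?E" "\<And>C. C \<in> ?V - {r} \<Longrightarrow> C \<in> b C"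
      using tree_parent_edges[OF tree r(2)] by blast
    let ?R = "\<lambda>C n. marginal_min C n / marginal_min (\<Inter>(b C)) n"
    have quot: "(\<Prod>C\<in>?V. marginal_min C n) / (\<Prod>e\<in>?E. marginal_min (\<Inter>e) n)
        = marginal_min r n * (\<Prod>C\<in>?V - {r}. ?R C n)" for n
    proof -
      have "(\<Prod>e\<in>?E. marginal_min (\<Inter>e) n) = (\<Prod>C\<in>?V - {r}. marginal_min (\<Inter>(b C)) n)"
        by (rule prod.reindex_bij_betw[OF b(1), symmetric])
      then show ?thesis using finV r(2) by (simp add: prod.remove prod_dividef)
    qed
    \<comment> \<open>If the denominator is 0, the ratio is 0 by convention, and the bounds persist.\<close>
    have ratio: "0 \<le> ?R C n \<and> ?R C n \<le> 1" if C: "C \<in> ?V - {r}" for C n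
    proof -
      have "marginal_min C n \<le> marginal_min (\<Inter>(b C)) n" using b(2)[OF C] subV C by (intro marginal_min_antimono) auto
      moreover have "0 \<le> marginal_min C n" using subV C by (intro marginal_min_nonneg) auto
      ultimately show ?thesis by (auto simp: divide_le_eq_1)
    qed
    have prod01: "0 \<le> (\<Prod>C\<in>?V - {r}. ?R C n)" "(\<Prod>C\<in>?V - {r}. ?R C n) \<le> 1" for n
      using ratio by (auto intro!: prod_nonneg prod_le_1)
    have Mr: "0 \<le> marginal_min r n" "marginal_min r n \<le> marginal_min (\<Inter>e0) n" for n
      using marginal_min_nonneg[OF subV[OF r(2)]] marginal_min_antimono[of "\<Inter>e0" r, OF _ subV[OF r(2)]] r(1) by auto
    have "marginal_min (\<Inter>e0) \<longlonglongrightarrow> 0" using Lim[OF subE[OF e0(1)]] e0(2) by simp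
    have Mr0: "marginal_min r \<longlonglongrightarrow> 0"
      by (rule tendsto_sandwich[OF _ _ tendsto_const \<open>marginal_min (\<Inter>e0) \<longlonglongrightarrow> 0\<close>]) (use Mr in auto)
    have Limr: "Lim r = 0" using LIMSEQ_unique[OF _ Mr0] Lim[OF subV[OF r(2)]] by auto
    have "(\<lambda>n. (\<Prod>C\<in>?V. marginal_min C n) / (\<Prod>e\<in>?E. marginal_min (\<Inter>e) n)) \<longlonglongrightarrow> 0"
      unfolding quot
    proof (rule tendsto_sandwich[OF _ _ tendsto_const Mr0])
      show "\<forall>\<^sub>F n in sequentially. 0 \<le> marginal_min r n * (\<Prod>C\<in>?V - {r}. ?R C n)"
        using Mr(1) prod01 by auto
      show "\<forall>\<^sub>F n in sequentially. marginal_min r n * (\<Prod>C\<in>?V - {r}. ?R C n) \<le> marginal_min r n"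
        by (intro always_eventually allI mult_right_le_one_le Mr prod01)
    qed
    then have lim: "(\<lambda>n. inverse (\<epsilon> ^ d) * inverse (rational_christoffel n \<mu> G J z \<epsilon>)) \<longlonglongrightarrow> 0"
      unfolding inv by (rule tendsto_mult_right_zero)
    \<comment> \<open>Since \<open>\<zeta>\<close> depends only on the set \<open>D\<close>, cliques and separators must not coincide.\<close>
    have not_separator: "\<Inter>e \<notin> ?V" if e: "e \<in> ?E" for e
    proof
      assume v: "\<Inter>e \<in> ?V"
      obtain A B where AB: "e = {A, B}" "A \<noteq> B"
        using simpleJ e unfolding simple_graph_def by (metis card_2_iff)
      then have "\<Inter>e = A" "\<Inter>e = B"
        using junction_tree_antichain[OF junction v] edge(2)[OF e] by auto
      then show False using AB by simp
    qed
    have "\<exists>\<zeta>. \<zeta> \<in> B_inf D z \<epsilon> \<and> (if D \<in> ?V then Lim D = \<epsilon> ^ card D * ?w D \<zeta> else ?w D \<zeta> \<noteq> 0)"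
      if "D \<in> ?V \<union> Inter ` ?E" for D
    proof (cases "D \<in> ?V")
      case False
      then have "D \<subseteq> {1..d}" using that subE by auto
      then show ?thesis using Lim[of D] False by auto
    qed (use clique_value in auto)
    then obtain \<zeta> where \<zeta>: "\<And>D. D \<in> ?V \<union> Inter ` ?E \<Longrightarrow>
        \<zeta> D \<in> B_inf D z \<epsilon> \<and> (if D \<in> ?V then Lim D = \<epsilon> ^ card D * ?w D (\<zeta> D) else ?w D (\<zeta> D) \<noteq> 0)"
      by metis
    have "?w r (\<zeta> r) = 0" using \<zeta>[of r] r(2) Limr eps_pos by simp
    then have "(\<Prod>C\<in>?V. ?w C (\<zeta> C)) = 0" using finV r(2) by (intro prod_zero) auto
    moreover have "?w (\<Inter>e) (\<zeta> (\<Inter>e)) \<noteq> 0" if "e \<in> ?E" for e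
      using \<zeta>[of "\<Inter>e"] not_separator[OF that] that by auto
    moreover have "\<forall>D\<in>?V \<union> {A \<inter> B | A B. {A, B} \<in> ?E}. \<zeta> D \<in> B_inf D (restrict z D) \<epsilon>"
      using \<zeta> by (intro in_cubes) blast
    ultimately show ?thesis using lim by (intro exI[of _ \<zeta>]) simp
  qed
qed

end
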